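(* Let $A:V\to V'$ be linear and continuous and assume there is $\omega>0$ with $\langle Ay,y\rangle_{V',V}\ge \omega\|y\|_V^2$ for all $y\in V$. Let $F\in\mathcal H$ with $F=F^*$, $F\ge 0$, and let $\Gamma\in\mathcal H$ with $\Gamma=\Gamma^*$, $\Gamma\ge 0$. Then there exists a unique $P\in\mathcal V$ solution to the equation $$A^*P+PA+P\Gamma P=F,$$ having the properties $P=P^*$, $P\ge 0$.
   Context: $V$ and $H$ are real separable Hilbert spaces, $V'$ is the dual of $V$, $H$ is identified with its dual, and $V\subset H\subset V'$ with dense and continuous injections, the embedding $V\subset H$ being compact. $(\cdot,\cdot)_H$ is the scalar product of $H$ and $\langle\cdot,\cdot\rangle_{V',V}$ the duality pairing. For separable Hilbert spaces $H_1,H_2$, $(H_1,H_2)_{H.S.}$ is the Hilbert space of Hilbert–Schmidt operators from $H_1$ to $H_2$, i.e. $P$ with $\sum_{n}\|Pe_n\|_{H_2}^2<\infty$ for a complete orthonormal basis $\{e_n\}$ of $H_1$, with scalar product $(P,Q)_{H.S.}=\sum_n(Pe_n,Qe_n)_{H_2}$. Set $\mathcal H:=(H,H)_{H.S.}$ and $\mathcal V:=(V',H)_{H.S.}\cap(H,V)_{H.S.}$; thus $P\in\mathcal V$ means that $P\in\mathcal H$ maps $H$ into $V$ as a Hilbert–Schmidt operator and extends to a Hilbert–Schmidt operator from $V'$ to $H$ (still denoted $P$). The dual $\mathcal V'$ of $\mathcal V$ is identified with $(V,H)_{H.S.}+(H,V')_{H.S.}$, and $\mathcal V\subset\mathcal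 H\subset\mathcal V'$ with dense continuous inclusions. $A^*:V\to V'$ is the adjoint of $A$, $\langle A^*u,v\rangle_{V',V}=\langle Av,u\rangle_{V',V}$. For $P\in\mathcal V$, $A^*P\in(H,V')_{H.S.}$ and $PA\in(V,H)_{H.S.}$, and the equation is understood in $\mathcal V'$, i.e. $A^*Py+PAy+P\Gamma Py=Fy$ in $V'$ for all $y\in V$. For $T\in\mathcal H$, $T^*$ is the adjoint in $H$ and $T\ge0$ means $(Ty,y)_H\ge0$ for all $y\in H$. *)

theory Defs
  imports "HOL-Analysis.Analysis"
begin

section \<open>The dual of a Hilbert space\<close>

text \<open>A copy of the bounded linear functionals, as a type constructor of its own: the general
  function space \<open>'v \<Rightarrow>\<^sub>L 'w\<close> has no inner product, the dual of a Hilbert space has one.\<close>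

typedef (overloaded) 'v topdual = "UNIV :: ('v::real_normed_vector \<Rightarrow>\<^sub>L real) set"
  morphisms functional_of Functional ..

declare Functional_inverse [OF UNIV_I, simp] functional_of_inverse [simp]

lemmas topdual_eq_iff = functional_of_inject [symmetric]

definition pairing :: "'v::real_normed_vector topdual \<Rightarrow> 'v \<Rightarrow> real"
  where "pairing f v = blinfun_apply (functional_of f) v"

text \<open>Meaningful for bounded linear arguments only, see \<open>pairing_dual_of\<close>.\<close>

definition dual_of :: "('v::real_normed_vector \<Rightarrow> real) \<Rightarrow> 'v topdual"
  where "dual_of g = Functional (Blinfun g)"

instantiation topdual :: (real_normed_vector) real_normed_vector
begin

definition zero_topdual :: "'a topdual" where "zero_topdual = Functional 0"
definition plus_topdual :: "'a topdual \<Rightarrow> 'a topdual \<Rightarrow> 'a topdual"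
  where "plus_topdual f g = Functional (functional_of f + functional_of g)"
definition minus_topdual :: "'a topdual \<Rightarrow> 'a topdual \<Rightarrow> 'a topdual"
  where "minus_topdual f g = Functional (functional_of f - functional_of g)"
definition uminus_topdual :: "'a topdual \<Rightarrow> 'a topdual"
  where "uminus_topdual f = Functional (- functional_of f)"
definition scaleR_topdual :: "real \<Rightarrow> 'a topdual \<Rightarrow> 'a topdual"
  where "scaleR_topdual c f = Functional (c *\<^sub>R functional_of f)"
definition norm_topdual :: "'a topdual \<Rightarrow> real"
  where "norm_topdual f = norm (functional_of f)"
definition sgn_topdual :: "'a topdual \<Rightarrow> 'a topdual"
  where "sgn_topdual f = scaleR (inverse (norm f)) f"
definition dist_topdual :: "'a topdual \<Rightarrow> 'a topdual \<Rightarrow> real"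
  where "dist_topdual f g = norm (f - g)"
definition [code del]:
  "(uniformity :: ('a topdual \<times> 'a topdual) filter) =
     (INF e\<in>{0 <..}. principal {(x, y). dist x y < e})"
definition open_topdual :: "'a topdual set \<Rightarrow> bool" where [code del]:
  "open_topdual S = (\<forall>x\<in>S. \<forall>\<^sub>F (x', y) in uniformity. x' = x \<longrightarrow> y \<in> S)"

instance
  by standard
    (auto simp: topdual_eq_iff zero_topdual_def plus_topdual_def minus_topdual_def
      uminus_topdual_def scaleR_topdual_def norm_topdual_def sgn_topdual_def dist_topdual_def
      uniformity_topdual_def open_topdual_def algebra_simps intro: norm_triangle_ineq)

end

lemma functional_of_simps [simp]:
  "functional_of 0 = 0"
  "functional_of (f + g) = functional_of f + functional_of g"
  "functional_of (f - g) = functional_of f - functional_of g"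
  "functional_of (- f) = - functional_of f"
  "functional_of (c *\<^sub>R f) = c *\<^sub>R functional_of f"
  by (simp_all add: zero_topdual_def plus_topdual_def minus_topdual_def
      uminus_topdual_def scaleR_topdual_def)

lemma pairing_simps [simp]:
  "pairing 0 v = 0"
  "pairing (f + g) v = pairing f v + pairing g v"
  "pairing (f - g) v = pairing f v - pairing g v"
  "pairing (- f) v = - pairing f v"
  "pairing (c *\<^sub>R f) v = c * pairing f v"
  by (simp_all add: pairing_def blinfun.bilinear_simps)

lemma topdual_eqI: "(\<And>v. pairing f v = pairing g v) \<Longrightarrow> f = g"
  unfolding pairing_def topdual_eq_iff by (rule blinfun_eqI) auto

lemma bounded_linear_pairing: "bounded_linear (pairing f)"
proof -
  have "pairing f = blinfun_apply (functional_of f)"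
    by (auto simp: pairing_def)
  then show ?thesis
    by (simp add: blinfun.bounded_linear_right)
qed

lemma norm_topdual: "norm f = onorm (pairing f)"
proof -
  have "pairing f = blinfun_apply (functional_of f)"
    by (auto simp: pairing_def)
  then show ?thesis
    by (simp add: norm_topdual_def norm_blinfun.rep_eq)
qed

lemma pairing_dual_of: "bounded_linear g \<Longrightarrow> pairing (dual_of g) v = g v"
  by (simp add: pairing_def dual_of_def bounded_linear_Blinfun_apply)

text \<open>Riesz representation, on closed subspaces so that it also yields orthogonal projections:
  the representative minimises \<open>J u = \<parallel>u\<parallel>\<^sup>2 - 2 f u\<close>.\<close>

lemma riesz_subspace:
  fixes f :: "'v::{real_inner, complete_space} \<Rightarrow> real"
  assumes W: "closed W" "subspace W" and f: "bounded_linear f"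
  shows "\<exists>u\<in>W. \<forall>w\<in>W. f w = u \<bullet> w"
proof -
  interpret f: bounded_linear f by fact
  define J where "J u = (norm u)\<^sup>2 - 2 * f u" for u
  define m where "m = Inf (J ` W)"
  have lb: "- (onorm f)\<^sup>2 \<le> J u" for u
  proof -
    have "f u \<le> onorm f * norm u"
      using onorm[OF f, of u] by (simp add: abs_le_iff)
    moreover have "0 \<le> (norm u - onorm f)\<^sup>2" by simp
    ultimately show ?thesis
      unfolding J_def power2_diff by (simp add: mult.commute)
  qed
  have bdd: "bdd_below (J ` W)"
    using lb by (auto intro!: bdd_belowI)
  have W0: "0 \<in> W" using W(2) by (rule subspace_0)
  have m_le: "m \<le> J u" if "u \<in> W" for u
    unfolding m_def using bdd that by (auto intro: cINF_lower)
  have "\<exists>u\<in>W. J u < m + inverse (real (Suc n))" for n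
  proof -
    have "Inf (J ` W) < m + inverse (real (Suc n))"
      unfolding m_def by simp
    then show ?thesis
      using W0 by (subst (asm) cInf_less_iff[OF _ bdd]) auto
  qed
  then obtain u where uW: "\<And>n. u n \<in> W"
    and uJ: "\<And>n. J (u n) < m + inverse (real (Suc n))"
    by metis
  have par: "(norm (a - b))\<^sup>2 = 2 * J a + 2 * J b - 4 * J ((1/2) *\<^sub>R (a + b))" for a b
    unfolding J_def
    by (simp add: power2_norm_eq_inner f.scaleR f.add inner_simps algebra_simps inner_commute)
  have dist_u: "(norm (u a - u b))\<^sup>2 \<le> 2 * inverse (real (Suc a)) + 2 * inverse (real (Suc b))"
    for a b
  proof -
    have "(1/2) *\<^sub>R (u a + u b) \<in> W"
      using W(2) uW by (intro subspace_scale subspace_add) auto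
    then have "m \<le> J ((1/2) *\<^sub>R (u a + u b))" by (rule m_le)
    then show ?thesis
      using par[of "u a" "u b"] uJ[of a] uJ[of b] by linarith
  qed
  have "Cauchy u"
  proof (rule metric_CauchyI)
    fix e :: real assume e: "0 < e"
    obtain N where N: "inverse (real (Suc N)) < e\<^sup>2 / 4"
      using reals_Archimedean[of "e\<^sup>2 / 4"] e by auto
    have "dist (u a) (u b) < e" if "a \<ge> N" "b \<ge> N" for a b
    proof -
      have "inverse (real (Suc a)) \<le> inverse (real (Suc N))"
           "inverse (real (Suc b)) \<le> inverse (real (Suc N))"
        using that by (auto intro!: le_imp_inverse_le)
      then have "(norm (u a - u b))\<^sup>2 < e\<^sup>2"
        using dist_u[of a b] N by linarith
      then show ?thesis
        using e by (simp add: dist_norm power_less_imp_less_base)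
    qed
    then show "\<exists>N. \<forall>a\<ge>N. \<forall>b\<ge>N. dist (u a) (u b) < e" by blast
  qed
  then obtain l where l: "u \<longlonglongrightarrow> l"
    using Cauchy_convergent convergent_def by blast
  have lW: "l \<in> W"
    using W(1) uW l closed_sequentially by blast
  have "(\<lambda>n. J (u n)) \<longlonglongrightarrow> J l"
    unfolding J_def by (intro tendsto_intros l f.tendsto)
  moreover have "(\<lambda>n. m + inverse (real (Suc n))) \<longlonglongrightarrow> m + 0"
    by (intro tendsto_intros LIMSEQ_inverse_real_of_nat)
  ultimately have "J l \<le> m + 0"
    using uJ by (intro LIMSEQ_le) (auto intro: less_imp_le)
  then have Jl: "J l \<le> J w" if "w \<in> W" for w
    using m_le[OF that] by simp
  have "f w = l \<bullet> w" if w: "w \<in> W" for w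
  proof (cases "w = 0")
    case True
    then show ?thesis by (simp add: f.zero)
  next
    case False
    define d where "d = l \<bullet> w - f w"
    define t where "t = - d / (w \<bullet> w)"
    have "l + t *\<^sub>R w \<in> W"
      using W(2) lW w by (intro subspace_add subspace_scale)
    then have "J l \<le> J (l + t *\<^sub>R w)" by (rule Jl)
    also have "J (l + t *\<^sub>R w) = J l + 2 * t * d + t * t * (w \<bullet> w)"
      unfolding J_def d_def
      by (simp add: power2_norm_eq_inner f.scaleR f.add algebra_simps inner_commute)
    also have "\<dots> = J l - d * d / (w \<bullet> w)"
      using False unfolding t_def by (simp add: field_simps)
    finally have "d * d / (w \<bullet> w) \<le> 0" by simp
    moreover have "0 < w \<bullet> w" using False by simp
    ultimately have "d * d \<le> 0"
      by (simp add: divide_le_0_iff)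
    then have "d = 0"
      by (metis mult_eq_0_iff order_antisym zero_le_square)
    then show ?thesis by (simp add: d_def)
  qed
  with lW show ?thesis by blast
qed

definition riesz :: "'v::{real_inner, complete_space} topdual \<Rightarrow> 'v"
  where "riesz f = (THE u. \<forall>v. pairing f v = u \<bullet> v)"

lemma pairing_riesz: "pairing f v = riesz f \<bullet> v"
proof -
  obtain u where u: "\<forall>v. pairing f v = u \<bullet> v"
    using riesz_subspace[OF closed_UNIV subspace_UNIV bounded_linear_pairing[of f]] by auto
  have "w = u" if "\<forall>v. pairing f v = w \<bullet> v" for w
  proof -
    have "(w - u) \<bullet> (w - u) = 0"
      using u that by (metis inner_diff_left right_minus_eq)
    then show ?thesis by simp
  qed
  with u have "\<forall>v. pairing f v = riesz f \<bullet> v"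
    unfolding riesz_def by (intro theI[where P = "\<lambda>u. \<forall>v. pairing f v = u \<bullet> v"]) auto
  then show ?thesis by blast
qed

lemma riesz_eqI: "(\<And>v. pairing f v = u \<bullet> v) \<Longrightarrow> riesz f = u"
  by (metis pairing_riesz inner_diff_left inner_eq_zero_iff right_minus_eq)

lemma riesz_dual_of [simp]: "riesz (dual_of (\<lambda>v. u \<bullet> v)) = u"
  by (intro riesz_eqI pairing_dual_of bounded_linear_inner_right)

lemma dual_of_riesz [simp]: "dual_of (\<lambda>v. riesz f \<bullet> v) = f"
  by (intro topdual_eqI) (simp add: pairing_dual_of bounded_linear_inner_right pairing_riesz)

lemma riesz_simps [simp]:
  "riesz (f + g) = riesz f + riesz g"
  "riesz (f - g) = riesz f - riesz g"
  "riesz (c *\<^sub>R f) = c *\<^sub>R riesz f"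
  by (rule riesz_eqI, simp add: pairing_riesz [symmetric] inner_simps)+

lemma norm_riesz: "norm (riesz f) = norm f"
proof -
  have "onorm (\<lambda>v. riesz f \<bullet> v) = norm (riesz f)"
  proof (rule antisym)
    show "onorm (\<lambda>v. riesz f \<bullet> v) \<le> norm (riesz f)"
      by (intro onorm_bound) (auto simp: Cauchy_Schwarz_ineq2)
    show "norm (riesz f) \<le> onorm (\<lambda>v. riesz f \<bullet> v)"
    proof (cases "riesz f = 0")
      case True
      then show ?thesis by (simp add: onorm_zero)
    next
      case False
      have "norm (riesz f \<bullet> riesz f) \<le> onorm (\<lambda>v. riesz f \<bullet> v) * norm (riesz f)"
        by (intro onorm bounded_linear_inner_right)
      then show ?thesis
        using False by (simp add: dot_square_norm power2_eq_square)
    qed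
  qed
  moreover have "pairing f = (\<lambda>v. riesz f \<bullet> v)"
    by (auto simp: pairing_riesz)
  ultimately show ?thesis by (simp add: norm_topdual)
qed

text \<open>The inner product whose norm is the dual norm.\<close>

instantiation topdual :: ("{real_inner, complete_space}") real_inner
begin

definition inner_topdual :: "'a topdual \<Rightarrow> 'a topdual \<Rightarrow> real"
  where "inner_topdual f g = riesz f \<bullet> riesz g"

instance
proof
  fix f g h :: "'a topdual" and r :: real
  show "f \<bullet> g = g \<bullet> f" by (simp add: inner_topdual_def inner_commute)
  show "(f + g) \<bullet> h = f \<bullet> h + g \<bullet> h" by (simp add: inner_topdual_def inner_simps)
  show "(r *\<^sub>R f) \<bullet> g = r * (f \<bullet> g)" by (simp add: inner_topdual_def)
  show "0 \<le> f \<bullet> f" by (simp add: inner_topdual_def)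
  show n: "norm f = sqrt (f \<bullet> f)"
    by (simp add: inner_topdual_def norm_riesz [symmetric] norm_eq_sqrt_inner)
  show "(f \<bullet> f = 0) = (f = 0)"
    using n by (metis norm_eq_zero real_sqrt_eq_0_iff)
qed

end

lemma dist_riesz: "dist (riesz f) (riesz g) = dist f g"
  using norm_riesz[of "f - g"] by (simp add: dist_norm)

lemma bounded_linear_riesz: "bounded_linear riesz"
  by (rule bounded_linear_intro[where K = 1]) (auto simp: norm_riesz)

instance topdual :: ("{real_inner, complete_space}") complete_space
proof
  fix X :: "nat \<Rightarrow> 'a topdual"
  assume "Cauchy X"
  then have "Cauchy (\<lambda>n. riesz (X n))"
    by (simp add: Cauchy_def dist_riesz)
  then obtain l where "(\<lambda>n. riesz (X n)) \<longlonglongrightarrow> l"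
    using Cauchy_convergent convergent_def by blast
  then have "(\<lambda>n. riesz (X n)) \<longlonglongrightarrow> riesz (dual_of (\<lambda>v. l \<bullet> v))" by simp
  then have "X \<longlonglongrightarrow> dual_of (\<lambda>v. l \<bullet> v)"
    unfolding tendsto_iff dist_riesz .
  then show "convergent X" by (auto simp: convergent_def)
qed

instance topdual :: ("{real_inner, polish_space}") polish_space
proof
  obtain B :: "'a set set" where B: "countable B" "topological_basis B"
    using ex_countable_basis by blast
  have cont: "continuous_on UNIV (riesz :: 'a topdual \<Rightarrow> 'a)"
    using bounded_linear_riesz by (intro linear_continuous_on)
  have conti: "continuous_on UNIV (\<lambda>u::'a. dual_of (\<lambda>v. u \<bullet> v))"
    unfolding continuous_on_iff
    by (metis dist_riesz riesz_dual_of)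
  have "topological_basis ((\<lambda>S. riesz -` S) ` B :: 'a topdual set set)"
  proof (rule topological_basisI)
    fix S :: "'a topdual set"
    assume "S \<in> (\<lambda>S. riesz -` S) ` B"
    then show "open S"
      using B(2) cont by (auto simp: topological_basis_open open_vimage)
  next
    fix S :: "'a topdual set" and x
    assume S: "open S" "x \<in> S"
    let ?T = "(\<lambda>u. dual_of (\<lambda>v. u \<bullet> v)) -` S"
    have "open ?T" using S(1) conti by (rule open_vimage)
    moreover have "riesz x \<in> ?T" using S(2) by simp
    ultimately obtain C where C: "C \<in> B" "riesz x \<in> C" "C \<subseteq> ?T"
      using topological_basisE[OF B(2)] by blast
    have "riesz -` C \<subseteq> S"
    proof
      fix y assume "y \<in> riesz -` C"
      then have "dual_of (\<lambda>v. riesz y \<bullet> v) \<in> S" using C(3) by blast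
      then show "y \<in> S" by simp
    qed
    with C(1,2) show "\<exists>D\<in>(\<lambda>S. riesz -` S) ` B. x \<in> D \<and> D \<subseteq> S" by blast
  qed
  with B(1) show "\<exists>B::'a topdual set set. countable B \<and> open = generate_topology B"
    by (metis countable_image topological_basis_imp_subbasis)
qed

text \<open>The library's \<^const>\<open>adjoint\<close> is a choice operator; on Hilbert spaces it is the adjoint.\<close>

lemma inner_adjoint:
  fixes T :: "'a::{real_inner, complete_space} \<Rightarrow> 'b::real_inner"
  assumes T: "bounded_linear T"
  shows "T x \<bullet> y = x \<bullet> adjoint T y"
proof -
  have "\<exists>u. \<forall>x. T x \<bullet> y = u \<bullet> x" for y
    using riesz_subspace[OF closed_UNIV subspace_UNIV bounded_linear_inner_left_comp[OF T, of y]]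
    by auto
  then obtain g where "\<forall>y x. T x \<bullet> y = x \<bullet> g y"
    by (metis inner_commute)
  then have "\<forall>x y. T x \<bullet> y = x \<bullet> adjoint T y"
    using adjoint_unique[of T g] by simp
  then show ?thesis by blast
qed

section \<open>Hilbert--Schmidt operators and Gelfand triples\<close>

definition orthonormal_basis :: "'a::real_inner set \<Rightarrow> bool" where
  "orthonormal_basis B \<longleftrightarrow>
     pairwise orthogonal B \<and> (\<forall>e\<in>B. norm e = 1) \<and> closure (span B) = UNIV"

definition hilbert_schmidt :: "('a::real_inner \<Rightarrow> 'b::real_inner) \<Rightarrow> bool" where
  "hilbert_schmidt P \<longleftrightarrow> bounded_linear P \<and>
     (\<exists>B. orthonormal_basis B \<and> (\<lambda>e. (norm (P e))\<^sup>2) summable_on B)"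

definition compact_operator :: "('a::real_normed_vector \<Rightarrow> 'b::real_normed_vector) \<Rightarrow> bool" where
  "compact_operator T \<longleftrightarrow> bounded_linear T \<and> (\<forall>S. bounded S \<longrightarrow> compact (closure (T ` S)))"

text \<open>The inclusions \<open>V \<subset> H \<subset> V'\<close> are maps \<open>i : V \<rightarrow> H\<close> and \<open>to_dual i : H \<rightarrow> V'\<close>, the latter sending
  \<open>h\<close> to the functional \<open>v \<mapsto> (h, i v)\<close>, which is how \<open>H\<close> is identified with its own dual.\<close>

definition to_dual ::
  "('v::real_normed_vector \<Rightarrow> 'h::real_inner) \<Rightarrow> 'h \<Rightarrow> 'v topdual" where
  "to_dual i h = dual_of (\<lambda>v. h \<bullet> i v)"

text \<open>That \<open>to_dual i\<close> is injective, continuous and has dense range follows, see below.\<close>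

definition gelfand_triple ::
  "('v::{real_inner, polish_space} \<Rightarrow> 'h::{real_inner, polish_space}) \<Rightarrow> bool" where
  "gelfand_triple i \<longleftrightarrow> bounded_linear i \<and> inj i \<and> closure (range i) = UNIV"

lemma pairing_to_dual: "bounded_linear i \<Longrightarrow> pairing (to_dual i h) v = h \<bullet> i v"
  unfolding to_dual_def
  by (intro pairing_dual_of bounded_linear_compose[OF bounded_linear_inner_right])

lemma bounded_linear_to_dual:
  fixes i :: "'v::real_normed_vector \<Rightarrow> 'h::real_inner"
  assumes i: "bounded_linear i"
  shows "bounded_linear (to_dual i)"
proof (rule bounded_linear_intro[where K = "onorm i"])
  fix x y :: 'h and r :: real
  show "to_dual i (x + y) = to_dual i x + to_dual i y"
    by (intro topdual_eqI) (simp add: pairing_to_dual[OF i] inner_simps)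
  show "to_dual i (r *\<^sub>R x) = r *\<^sub>R to_dual i x"
    by (intro topdual_eqI) (simp add: pairing_to_dual[OF i])
  have "norm (pairing (to_dual i x) v) \<le> norm x * onorm i * norm v" for v
  proof -
    have "norm (pairing (to_dual i x) v) \<le> norm x * norm (i v)"
      by (simp add: pairing_to_dual[OF i] Cauchy_Schwarz_ineq2)
    also have "\<dots> \<le> norm x * (onorm i * norm v)"
      by (intro mult_left_mono onorm[OF i]) simp
    finally show ?thesis by (simp add: mult.assoc)
  qed
  then show "norm (to_dual i x) \<le> norm x * onorm i"
    unfolding norm_topdual
    by (intro onorm_bound) (auto simp: onorm_pos_le[OF i])
qed

lemma inj_to_dual:
  assumes "gelfand_triple i"
  shows "inj (to_dual i)"
proof (rule injI)
  fix x y assume eq: "to_dual i x = to_dual i y"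
  have i: "bounded_linear i" and d: "closure (range i) = UNIV"
    using assms by (auto simp: gelfand_triple_def)
  have "(x - y) \<bullet> i v = 0" for v
    using arg_cong[OF eq, of "\<lambda>f. pairing f v"]
    by (simp add: inner_diff_left pairing_to_dual[OF i])
  then have "range i \<subseteq> {w. (x - y) \<bullet> w = 0}" by auto
  then have "closure (range i) \<subseteq> {w. (x - y) \<bullet> w = 0}"
    by (intro closure_minimal closed_hyperplane)
  then have "(x - y) \<bullet> (x - y) = 0" using d by blast
  then show "x = y" by simp
qed

lemma subspace_closure:
  fixes S :: "'a::real_normed_vector set"
  assumes S: "subspace S"
  shows "subspace (closure S)"
  unfolding subspace_def
proof (intro conjI ballI allI)
  show "0 \<in> closure S"
    using subspace_0[OF S] closure_subset by blast
next
  fix x y assume "x \<in> closure S" "y \<in> closure S"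
  then obtain a b where "\<And>n. a n \<in> S" "a \<longlonglongrightarrow> x" "\<And>n. b n \<in> S" "b \<longlonglongrightarrow> y"
    by (metis closure_sequential)
  then show "x + y \<in> closure S"
    unfolding closure_sequential
    by (intro exI[of _ "\<lambda>n. a n + b n"]) (simp add: subspace_add[OF S] tendsto_add)
next
  fix x and c :: real assume "x \<in> closure S"
  then obtain a where "\<And>n. a n \<in> S" "a \<longlonglongrightarrow> x"
    by (metis closure_sequential)
  then show "c *\<^sub>R x \<in> closure S"
    unfolding closure_sequential
    by (intro exI[of _ "\<lambda>n. c *\<^sub>R a n"]) (simp add: subspace_scale[OF S] tendsto_scaleR)
qed

lemma dense_to_dual:
  assumes "gelfand_triple i"
  shows "closure (range (to_dual i)) = UNIV"
proof -
  have i: "bounded_linear i" and inj: "inj i"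
    using assms by (auto simp: gelfand_triple_def)
  let ?W = "closure (range (to_dual i))"
  have lin: "linear (to_dual i)"
    using bounded_linear_to_dual[OF i] by (rule bounded_linear.linear)
  have W: "closed ?W" "subspace ?W"
    by (rule closed_closure, rule subspace_closure[OF linear_subspace_image[OF lin subspace_UNIV]])
  have "x \<in> ?W" for x
  proof -
    obtain u where u: "u \<in> ?W" "\<forall>w\<in>?W. x \<bullet> w = u \<bullet> w"
      using riesz_subspace[OF W bounded_linear_inner_right[of x]] by blast
    have "h \<bullet> i (riesz (x - u)) = 0" for h
    proof -
      have "to_dual i h \<in> ?W" by (rule subsetD[OF closure_subset rangeI])
      then have "0 = (x - u) \<bullet> to_dual i h" using u(2) by (simp add: inner_diff_left)
      also have "\<dots> = pairing (to_dual i h) (riesz (x - u))"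
        unfolding inner_topdual_def pairing_riesz by (rule inner_commute)
      finally show ?thesis by (simp add: pairing_to_dual[OF i])
    qed
    from this[of "i (riesz (x - u))"] have "i (riesz (x - u)) = i 0"
      using linear_0[OF bounded_linear.linear[OF i]] by simp
    then have "riesz (x - u) = 0"
      by (rule injD[OF inj])
    then have "norm (x - u) = 0"
      using norm_riesz[of "x - u"] by (simp del: riesz_simps)
    then have "x = u" by simp
    with u(1) show ?thesis by blast
  qed
  then show ?thesis by blast
qed

section \<open>The operator space and the Riccati equation\<close>

text \<open>For \<open>P : H \<rightarrow> H\<close> with values in the image of \<open>V\<close>, \<open>restr i P\<close> is \<open>P\<close> as a map \<open>H \<rightarrow> V\<close>;
  \<open>ext i P\<close> is its continuous extension to \<open>V'\<close>, unique when it exists (\<open>ext_eqI\<close>).\<close>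

definition restr :: "('v \<Rightarrow> 'h) \<Rightarrow> ('h \<Rightarrow> 'h) \<Rightarrow> 'h \<Rightarrow> 'v" where
  "restr i P = inv i \<circ> P"

definition ext ::
  "('v::real_normed_vector \<Rightarrow> 'h::real_inner) \<Rightarrow> ('h \<Rightarrow> 'h) \<Rightarrow> 'v topdual \<Rightarrow> 'h" where
  "ext i P = (THE Q. bounded_linear Q \<and> (\<forall>h. Q (to_dual i h) = P h))"

definition HS_V ::
  "('v::{real_inner, complete_space} \<Rightarrow> 'h::real_inner) \<Rightarrow> ('h \<Rightarrow> 'h) set" where
  "HS_V i = {P. hilbert_schmidt P
     \<and> range P \<subseteq> range i \<and> hilbert_schmidt (restr i P)
     \<and> (\<exists>Q :: 'v topdual \<Rightarrow> 'h. hilbert_schmidt Q \<and> (\<forall>h. Q (to_dual i h) = P h))}"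

lemma ext_eqI:
  assumes i: "gelfand_triple i" and Q: "bounded_linear Q" "\<And>h. Q (to_dual i h) = P h"
  shows "ext i P = Q"
  unfolding ext_def
proof (rule the_equality)
  show "bounded_linear Q \<and> (\<forall>h. Q (to_dual i h) = P h)" using Q by blast
  fix R assume R: "bounded_linear R \<and> (\<forall>h. R (to_dual i h) = P h)"
  have "closed {x. R x = Q x}"
    using R Q(1) by (intro closed_Collect_eq linear_continuous_on) auto
  then have "closure (range (to_dual i)) \<subseteq> {x. R x = Q x}"
    using R Q(2) by (intro closure_minimal) auto
  then show "R = Q" using dense_to_dual[OF i] by auto
qed

definition dual_adjoint ::
  "('v::real_normed_vector \<Rightarrow> 'v topdual) \<Rightarrow> 'v \<Rightarrow> 'v topdual" where
  "dual_adjoint A u = dual_of (\<lambda>v. pairing (A v) u)"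

lemma pairing_dual_adjoint:
  assumes A: "bounded_linear A"
  shows "pairing (dual_adjoint A u) v = pairing (A v) u"
  unfolding dual_adjoint_def
proof (rule pairing_dual_of, rule bounded_linear_intro[where K = "onorm A * norm u"])
  interpret A: bounded_linear A by fact
  fix x y and r :: real
  show "pairing (A (x + y)) u = pairing (A x) u + pairing (A y) u" by (simp add: A.add)
  show "pairing (A (r *\<^sub>R x)) u = r *\<^sub>R pairing (A x) u" by (simp add: A.scaleR)
  have "norm (pairing (A x) u) \<le> norm (A x) * norm u"
    unfolding norm_topdual by (rule onorm[OF bounded_linear_pairing])
  also have "\<dots> \<le> onorm A * norm x * norm u"
    by (intro mult_right_mono onorm[OF A]) simp
  finally show "norm (pairing (A x) u) \<le> norm x * (onorm A * norm u)"
    by (simp add: ac_simps)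
qed

text \<open>\<open>A\<^sup>* P y + P A y + P \<Gamma> P y = F y\<close> in \<open>V'\<close> for all \<open>y \<in> V\<close>. In the first term \<open>P\<close> acts \<open>H \<rightarrow> V\<close>,
  in the second \<open>V' \<rightarrow> H\<close>.\<close>

definition riccati_equation ::
  "('v::real_normed_vector \<Rightarrow> 'h::real_inner) \<Rightarrow> ('v \<Rightarrow> 'v topdual) \<Rightarrow>
     ('h \<Rightarrow> 'h) \<Rightarrow> ('h \<Rightarrow> 'h) \<Rightarrow> ('h \<Rightarrow> 'h) \<Rightarrow> bool" where
  "riccati_equation i A \<Gamma> F P \<longleftrightarrow>
     (\<forall>y. dual_adjoint A (restr i P (i y)) + to_dual i (ext i P (A y))
            + to_dual i (P (\<Gamma> (P (i y)))) = to_dual i (F (i y)))"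

definition nonneg_operator :: "('h::real_inner \<Rightarrow> 'h) \<Rightarrow> bool" where
  "nonneg_operator T \<longleftrightarrow> (\<forall>y. 0 \<le> T y \<bullet> y)"

end

theory Submission
  imports Defs
begin

text \<open>On the Hilbert space of Hilbert--Schmidt operators \<open>H \<rightarrow> V\<close> that are symmetric in \<open>H\<close>,
  the Lyapunov equation \<open>A\<^sup>* P + P A = G\<close> is solved by Lax--Milgram, since for symmetric \<open>Q\<close> both
  terms pair with \<open>Q\<close> in the same way. The substitute for monotonicity of \<open>P \<mapsto> P \<Gamma> P\<close>, which
  fails, is a Lyapunov function: if \<open>P \<ge> 0\<close> solves the Riccati equation, then \<open>A + \<Gamma> P\<close> is
  coercive for the inner product of \<open>\<epsilon> + P\<close> with small \<open>\<epsilon>\<close>. Testing with an extremal vector of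
  \<open>(D y, y) / ((\<epsilon> + P) y, y)\<close> therefore bounds any symmetric compact \<open>D\<close> that satisfies the
  linearised equation, and shows \<open>D \<le> 0\<close> if \<open>D\<close> is the difference of two solutions; this is
  uniqueness. For existence \<open>\<Gamma>\<close> is replaced by \<open>t \<Gamma>\<close>, and solvability is continued from \<open>t = 0\<close>
  to \<open>t = 1\<close> by contractions, with step length controlled by the same estimates.\<close>

section \<open>Orthonormal bases\<close>

text \<open>The regularisation \<open>\<epsilon>\<close> has two purposes. A nonnegative
  \<open>P\<close> alone is compact, so a quotient by \<open>(P y, y)\<close> need not attain its
  supremum. Moreover the relation \<open>D z = \<nu> (\<epsilon> z + P z)\<close> at an extremal
  vector can be solved for \<open>z\<close>, which shows that \<open>z\<close> lies in the image of
  \<open>V\<close>; only then may \<open>A\<close> be tested there. Such tests control operator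
  norms on \<open>H\<close>, whereas the contractions run in the Hilbert--Schmidt norm of maps from
  \<open>H\<close> to \<open>V\<close>. The equation itself closes this gap: it expresses
  \<open>P\<close>, and \<open>D\<close> in the linearised case, through the solution operator of
  the Lyapunov equation, which turns bounds for the quadratic term on \<open>H\<close> into bounds
  for maps into \<open>V\<close>. The contractions say nothing about signs. Nonnegativity survives a
  short step because a negative eigenvalue \<open>- s\<close> of a solution cannot be small: at the
  lowest eigenvector the linear terms are of order \<open>s\<close>, the quadratic one of order
  \<open>s\<^sup>2\<close>.\<close>

lemma ex_orthonormal_basis: "\<exists>B :: 'a::{real_inner, complete_space} set. orthonormal_basis B"
proof -
  define \<A> where "\<A> = {B :: 'a set. pairwise orthogonal B \<and> (\<forall>e\<in>B. norm e = 1)}"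
  have "\<exists>M\<in>\<A>. \<forall>X\<in>\<A>. M \<subseteq> X \<longrightarrow> X = M"
  proof (rule subset_Zorn')
    fix \<C> assume "subset.chain \<A> \<C>"
    then have "\<C> \<subseteq> \<A>" "chain\<^sub>\<subseteq> \<C>"
      by (auto simp: subset_chain_def chain_subset_def)
    then show "\<Union>\<C> \<in> \<A>"
      unfolding \<A>_def by (auto intro!: pairwise_chain_Union)
  qed
  then obtain M where M: "M \<in> \<A>" and max: "\<And>X. X \<in> \<A> \<Longrightarrow> M \<subseteq> X \<Longrightarrow> X = M"
    by blast
  let ?W = "closure (span M)"
  have W: "closed ?W" "subspace ?W"
    by (simp_all add: subspace_closure)
  have M_W: "M \<subseteq> ?W"
    using span_superset closure_subset by (rule subset_trans)
  have "x \<in> ?W" for x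
  proof (rule ccontr)
    assume x: "x \<notin> ?W"
    obtain u where u: "u \<in> ?W" "\<forall>w\<in>?W. x \<bullet> w = u \<bullet> w"
      using riesz_subspace[OF W bounded_linear_inner_right[of x]] by blast
    \<comment> \<open>The normalised residual of the projection onto \<open>?W\<close> could be
      added to \<open>M\<close>, against maximality.\<close>
    define d where "d = inverse (norm (x - u)) *\<^sub>R (x - u)"
    have d: "norm d = 1"
    proof -
      have "norm (x - u) \<noteq> 0" using x u(1) by auto
      then show ?thesis by (simp add: d_def)
    qed
    have orth: "d \<bullet> w = 0" if "w \<in> ?W" for w
      using u(2) that by (simp add: d_def inner_diff_left)
    have "insert d M \<in> \<A>"
      using M d orth M_W
      by (auto simp: \<A>_def pairwise_insert orthogonal_def inner_commute subset_iff)
    then have "insert d M = M"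
      by (rule max) auto
    then have "d \<in> ?W" using M_W by blast
    then show False using orth[of d] d by auto
  qed
  then show ?thesis
    using M by (auto simp: orthonormal_basis_def \<A>_def intro!: exI[of _ M])
qed

text \<open>Finite partial sums of the expansion are best approximations, so that density of the span
  bounds the defect.\<close>

lemma parseval:
  assumes B: "orthonormal_basis B"
  shows "((\<lambda>e. (x \<bullet> e)\<^sup>2) has_sum (norm x)\<^sup>2) B"
proof -
  have ortho: "e \<bullet> f = (if e = f then 1 else 0)" if "e \<in> B" "f \<in> B" for e f
    using B that
    by (auto simp: orthonormal_basis_def pairwise_def orthogonal_def dot_square_norm)
  \<comment> \<open>Completing the square. The identity serves twice: with arbitrary
    \<open>c\<close> it bounds the defect from above, with \<open>c e = x \<bullet> e\<close> it
    shows that the defect is nonnegative.\<close>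
  have expand: "(norm (x - (\<Sum>e\<in>G. c e *\<^sub>R e)))\<^sup>2
      = (norm x)\<^sup>2 - (\<Sum>e\<in>G. (x \<bullet> e)\<^sup>2) + (\<Sum>e\<in>G. (x \<bullet> e - c e)\<^sup>2)"
    if G: "finite G" "G \<subseteq> B" for G c
  proof -
    let ?y = "\<Sum>e\<in>G. c e *\<^sub>R e"
    have "?y \<bullet> ?y = (\<Sum>e\<in>G. c e * (\<Sum>f\<in>G. c f * (e \<bullet> f)))"
      by (simp add: inner_sum_left inner_sum_right inner_commute sum_distrib_left mult.left_commute)
    also have "\<dots> = (\<Sum>e\<in>G. c e * (\<Sum>f\<in>G. if e = f then c f else 0))"
      using G(2) by (intro sum.cong refl arg_cong2[where f = "(*)"]) (auto simp: ortho subset_iff)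
    also have "\<dots> = (\<Sum>e\<in>G. (c e)\<^sup>2)"
      using G(1) by (intro sum.cong refl) (simp add: power2_eq_square)
    finally have yy: "?y \<bullet> ?y = (\<Sum>e\<in>G. (c e)\<^sup>2)" .
    have xy: "x \<bullet> ?y = (\<Sum>e\<in>G. c e * (x \<bullet> e))"
      by (simp add: inner_sum_right)
    have "(norm (x - ?y))\<^sup>2 = (norm x)\<^sup>2 - 2 * (x \<bullet> ?y) + ?y \<bullet> ?y"
      unfolding power2_norm_eq_inner inner_diff_left inner_diff_right
      by (simp add: inner_commute[of ?y x])
    then have "(norm (x - ?y))\<^sup>2
        = (norm x)\<^sup>2 - 2 * (\<Sum>e\<in>G. c e * (x \<bullet> e)) + (\<Sum>e\<in>G. (c e)\<^sup>2)"
      unfolding xy yy .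
    then show ?thesis
      by (simp add: power2_diff sum.distrib sum_subtractf sum_distrib_left algebra_simps)
  qed
  show ?thesis
    unfolding has_sum_def
  proof (rule tendstoI)
    fix r :: real assume r: "0 < r"
    have "x \<in> closure (span B)"
      using B by (simp add: orthonormal_basis_def)
    then obtain y where y: "y \<in> span B" "dist y x < sqrt r"
      unfolding closure_approachable using r by (metis real_sqrt_gt_zero)
    obtain F c where F: "finite F" "F \<subseteq> B" and yF: "y = (\<Sum>e\<in>F. c e *\<^sub>R e)"
      using y(1) unfolding span_explicit by auto
    show "\<forall>\<^sub>F G in finite_subsets_at_top B. dist (\<Sum>e\<in>G. (x \<bullet> e)\<^sup>2) ((norm x)\<^sup>2) < r"
      unfolding eventually_finite_subsets_at_top
    proof (intro exI conjI allI impI)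
      fix G assume "finite G \<and> F \<subseteq> G \<and> G \<subseteq> B"
      then have G: "finite G" "F \<subseteq> G" "G \<subseteq> B" by auto
      \<comment> \<open>Padding with zero coefficients makes one approximant usable for every finite
        \<open>G\<close> above \<open>F\<close>.\<close>
      have y_G: "y = (\<Sum>e\<in>G. (if e \<in> F then c e else 0) *\<^sub>R e)"
        unfolding yF using G by (intro sum.mono_neutral_cong_left) auto
      have "(norm x)\<^sup>2 - (\<Sum>e\<in>G. (x \<bullet> e)\<^sup>2) \<le> (norm (x - y))\<^sup>2"
        unfolding y_G expand[OF G(1,3)] by (simp add: sum_nonneg)
      also have "\<dots> < (sqrt r)\<^sup>2"
        using y(2) by (intro power_strict_mono) (auto simp: dist_norm norm_minus_commute)
      finally have "(norm x)\<^sup>2 - (\<Sum>e\<in>G. (x \<bullet> e)\<^sup>2) < r"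
        using r by simp
      moreover have "0 \<le> (norm x)\<^sup>2 - (\<Sum>e\<in>G. (x \<bullet> e)\<^sup>2)"
        using expand[OF G(1,3), of "\<lambda>e. x \<bullet> e"] zero_le_power2[of "norm (x - (\<Sum>e\<in>G. (x \<bullet> e) *\<^sub>R e))"]
        by simp
      ultimately show "dist (\<Sum>e\<in>G. (x \<bullet> e)\<^sup>2) ((norm x)\<^sup>2) < r"
        by (simp add: dist_real_def)
    qed (use F in auto)
  qed
qed

text \<open>Polarisation of \<open>parseval\<close>.\<close>

lemma parseval_inner:
  assumes B: "orthonormal_basis B"
  shows "((\<lambda>e. (x \<bullet> e) * (y \<bullet> e)) has_sum x \<bullet> y) B"
proof -
  have "((\<lambda>e. 1/4 * ((x + y) \<bullet> e)\<^sup>2 + (-1/4) * ((x - y) \<bullet> e)\<^sup>2) has_sum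
      1/4 * (norm (x + y))\<^sup>2 + (-1/4) * (norm (x - y))\<^sup>2) B"
    by (intro has_sum_cmult_right has_sum_add parseval B)
  also have "(\<lambda>e. 1/4 * ((x + y) \<bullet> e)\<^sup>2 + (-1/4) * ((x - y) \<bullet> e)\<^sup>2) = (\<lambda>e. (x \<bullet> e) * (y \<bullet> e))"
    by (simp add: fun_eq_iff inner_simps power2_eq_square algebra_simps)
  also have "1/4 * (norm (x + y))\<^sup>2 + (-1/4) * (norm (x - y))\<^sup>2 = x \<bullet> y"
    by (simp add: power2_norm_eq_inner inner_simps inner_commute field_simps)
  finally show ?thesis .
qed

lemma orthonormal_basis_ext:
  assumes B: "orthonormal_basis B" and "bounded_linear f" "bounded_linear g"
    and eq: "\<And>e. e \<in> B \<Longrightarrow> f e = g e"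
  shows "f = g"
proof -
  have "closed {x. f x = g x}"
    using assms by (intro closed_Collect_eq linear_continuous_on)
  moreover have "span B \<subseteq> {x. f x = g x}"
    using linear_eq_on_span[of f g B] assms by (auto dest: bounded_linear.linear)
  ultimately have "closure (span B) \<subseteq> {x. f x = g x}"
    by (intro closure_minimal)
  then show ?thesis
    using B by (auto simp: orthonormal_basis_def)
qed

section \<open>The Hilbert space of Hilbert--Schmidt operators\<close>

text \<open>By Parseval in one variable at a time, both sums are iterated sums of
  \<open>(P e \<bullet> f)\<^sup>2\<close> over pairs of basis vectors.\<close>

lemma hilbert_schmidt_sum_adjoint:
  assumes B: "orthonormal_basis B" and B': "orthonormal_basis B'"
    and PQ: "\<And>x y. P x \<bullet> y = x \<bullet> Q y"
    and sum: "((\<lambda>e. (norm (P e))\<^sup>2) has_sum s) B"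
  shows "((\<lambda>f. (norm (Q f))\<^sup>2) has_sum s) B'"
proof -
  define g where "g = (\<lambda>(e, f). (P e \<bullet> f)\<^sup>2)"
  have g1: "((\<lambda>f. g (e, f)) has_sum (norm (P e))\<^sup>2) B'" for e
    unfolding g_def using parseval[OF B'] by simp
  have "g summable_on B \<times> B'"
    by (rule summable_on_SigmaI[OF g1]) (use sum in \<open>auto simp: g_def summable_on_def\<close>)
  with g1 sum have "(g has_sum s) (B \<times> B')"
    by (intro has_sum_SigmaI)
  then have "((\<lambda>(f, e). g (e, f)) has_sum s) (B' \<times> B)"
    by (simp add: has_sum_swap[of g])
  then show ?thesis
  proof (rule has_sum_SigmaD)
    fix f
    show "((\<lambda>e. (case (f, e) of (f, e) \<Rightarrow> g (e, f))) has_sum (norm (Q f))\<^sup>2) B"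
      using parseval[OF B, of "Q f"] by (simp add: g_def PQ inner_commute[of "Q f"])
  qed
qed

lemma bounded_linear_adjoint:
  fixes T :: "'a::{real_inner, complete_space} \<Rightarrow> 'b::real_inner"
  assumes T: "bounded_linear T"
  shows "bounded_linear (adjoint T)"
proof (rule bounded_linear_intro[where K = "onorm T"])
  have ext: "u = v" if "\<And>x::'a. x \<bullet> u = x \<bullet> v" for u v
    using that by (metis inner_commute vector_eq_rdot)
  show "adjoint T (x + y) = adjoint T x + adjoint T y" for x y
    by (rule ext) (simp add: inner_adjoint[OF T, symmetric] inner_simps)
  show "adjoint T (r *\<^sub>R x) = r *\<^sub>R adjoint T x" for r x
    by (rule ext) (simp add: inner_adjoint[OF T, symmetric] inner_simps)
  fix x
  have "norm (adjoint T x) * norm (adjoint T x) = T (adjoint T x) \<bullet> x"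
    by (simp add: inner_adjoint[OF T] power2_norm_eq_inner flip: power2_eq_square)
  also have "\<dots> \<le> norm (T (adjoint T x)) * norm x"
    by (rule norm_cauchy_schwarz)
  also have "\<dots> \<le> onorm T * norm (adjoint T x) * norm x"
    by (intro mult_right_mono onorm T) simp
  finally show "norm (adjoint T x) \<le> norm x * onorm T"
    by (cases "adjoint T x = 0") (simp_all add: onorm_pos_le[OF T] mult_ac)
qed

text \<open>\<open>hilbert_schmidt\<close> provides one suitable basis; passing to the adjoint and
  back reaches any other one, with the same sum.\<close>

lemma hilbert_schmidt_summable:
  fixes P :: "'a::{real_inner, complete_space} \<Rightarrow> 'b::{real_inner, complete_space}"
  assumes P: "hilbert_schmidt P" and B: "orthonormal_basis B"
  shows "(\<lambda>e. (norm (P e))\<^sup>2) summable_on B"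
proof -
  obtain B1 s where B1: "orthonormal_basis B1" "((\<lambda>e. (norm (P e))\<^sup>2) has_sum s) B1"
    and bl: "bounded_linear P"
    using P by (auto simp: hilbert_schmidt_def summable_on_def)
  obtain B2 :: "'b set" where B2: "orthonormal_basis B2"
    using ex_orthonormal_basis by blast
  have "((\<lambda>e. (norm (adjoint P e))\<^sup>2) has_sum s) B2"
    using B1(1) B2 inner_adjoint[OF bl] B1(2) by (rule hilbert_schmidt_sum_adjoint)
  then have "((\<lambda>e. (norm (P e))\<^sup>2) has_sum s) B"
    by (rule hilbert_schmidt_sum_adjoint[OF B2 B, rotated])
      (metis inner_adjoint[OF bl] inner_commute)
  then show ?thesis by (rule has_sum_imp_summable)
qed

lemma hilbert_schmidt_bounded_linear: "hilbert_schmidt P \<Longrightarrow> bounded_linear P"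
  by (simp add: hilbert_schmidt_def)

lemma hilbert_schmidtI:
  "bounded_linear P \<Longrightarrow> orthonormal_basis B \<Longrightarrow> (\<lambda>e. (norm (P e))\<^sup>2) summable_on B \<Longrightarrow>
    hilbert_schmidt P"
  by (auto simp: hilbert_schmidt_def)

lemma hilbert_schmidt_adjoint:
  fixes P :: "'a::{real_inner, complete_space} \<Rightarrow> 'b::{real_inner, complete_space}"
  assumes P: "hilbert_schmidt P" and Q: "bounded_linear Q" and PQ: "\<And>x y. P x \<bullet> y = x \<bullet> Q y"
  shows "hilbert_schmidt Q"
proof -
  obtain B :: "'a set" and B' :: "'b set" where B: "orthonormal_basis B" "orthonormal_basis B'"
    using ex_orthonormal_basis by metis
  obtain s where "((\<lambda>e. (norm (P e))\<^sup>2) has_sum s) B"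
    using hilbert_schmidt_summable[OF P B(1)] by (auto simp: summable_on_def)
  then have "((\<lambda>e. (norm (Q e))\<^sup>2) has_sum s) B'"
    using B PQ by (intro hilbert_schmidt_sum_adjoint[of B B' P Q])
  then show ?thesis
    using Q B(2) by (auto intro!: hilbert_schmidtI has_sum_imp_summable)
qed

section \<open>Square-summable families of vectors\<close>

lemma summable_on_norm_sq_bounded:
  assumes L: "bounded_linear L" and f: "(\<lambda>e. (norm (f e))\<^sup>2) summable_on B"
  shows "(\<lambda>e. (norm (L (f e)))\<^sup>2) summable_on B"
proof (rule summable_on_comparison_test)
  show "(\<lambda>e. (onorm L)\<^sup>2 * (norm (f e))\<^sup>2) summable_on B"
    using f by (rule summable_on_cmult_right)
  show "(norm (L (f e)))\<^sup>2 \<le> (onorm L)\<^sup>2 * (norm (f e))\<^sup>2" for e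
    unfolding power_mult_distrib[symmetric] by (intro power_mono onorm L) simp
qed simp

lemma summable_on_norm_sq_add:
  assumes "(\<lambda>e. (norm (f e))\<^sup>2) summable_on B" "(\<lambda>e. (norm (g e))\<^sup>2) summable_on B"
  shows "(\<lambda>e. (norm (f e + g e))\<^sup>2) summable_on B"
proof (rule summable_on_comparison_test)
  show "(\<lambda>e. 2 * ((norm (f e))\<^sup>2 + (norm (g e))\<^sup>2)) summable_on B"
    using assms by (intro summable_on_cmult_right summable_on_add)
  show "(norm (f e + g e))\<^sup>2 \<le> 2 * ((norm (f e))\<^sup>2 + (norm (g e))\<^sup>2)" for e
  proof -
    have "(norm (f e + g e))\<^sup>2 \<le> (norm (f e) + norm (g e))\<^sup>2"
      by (intro power_mono norm_triangle_ineq) simp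
    also have "\<dots> \<le> 2 * ((norm (f e))\<^sup>2 + (norm (g e))\<^sup>2)"
      using sum_squares_bound[of "norm (f e)" "norm (g e)"] by (simp add: power2_sum)
    finally show ?thesis .
  qed
qed simp

lemma summable_on_inner:
  fixes f g :: "'a \<Rightarrow> 'b::real_inner"
  assumes "(\<lambda>e. (norm (f e))\<^sup>2) summable_on B" "(\<lambda>e. (norm (g e))\<^sup>2) summable_on B"
  shows "(\<lambda>e. f e \<bullet> g e) summable_on B"
proof -
  have "(\<lambda>e. (norm (f e + g e))\<^sup>2) summable_on B"
    using assms by (rule summable_on_norm_sq_add)
  then have "(\<lambda>e. 1/2 * (norm (f e + g e))\<^sup>2 + (-1/2) * ((norm (f e))\<^sup>2 + (norm (g e))\<^sup>2)) summable_on B"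
    using assms by (intro summable_on_cmult_right summable_on_add)
  also have "(\<lambda>e. 1/2 * (norm (f e + g e))\<^sup>2 + (-1/2) * ((norm (f e))\<^sup>2 + (norm (g e))\<^sup>2))
      = (\<lambda>e. f e \<bullet> g e)"
    by (simp add: fun_eq_iff power2_norm_eq_inner inner_simps inner_commute field_simps)
  finally show ?thesis .
qed

lemma hilbert_schmidt_zero:
  "hilbert_schmidt (\<lambda>_::'a::{real_inner, complete_space}. 0 :: 'b::real_inner)"
  using ex_orthonormal_basis[where 'a = 'a] by (auto simp: hilbert_schmidt_def)

text \<open>As a type of its own, the space can be an instance of the classes of inner product
  spaces and complete spaces, so that Riesz representation and fixed point theorems apply to
  operators.\<close>

typedef (overloaded) ('a::"{real_inner, complete_space}", 'b::"{real_inner, complete_space}") hs =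
  "{P :: 'a \<Rightarrow> 'b. hilbert_schmidt P}"
  morphisms hs_apply Hs
  using hilbert_schmidt_zero by blast

lemma hs_eqI: "(\<And>x. hs_apply P x = hs_apply Q x) \<Longrightarrow> P = Q"
  by (simp add: fun_eq_iff flip: hs_apply_inject)

lemma hilbert_schmidt_hs_apply: "hilbert_schmidt (hs_apply P)"
  using hs_apply by blast

lemma hs_apply_Hs [simp]: "hilbert_schmidt P \<Longrightarrow> hs_apply (Hs P) = P"
  by (simp add: Hs_inverse)

lemma bounded_linear_hs_apply: "bounded_linear (hs_apply P)"
  by (rule hilbert_schmidt_bounded_linear[OF hilbert_schmidt_hs_apply])

lemma hilbert_schmidt_comp:
  assumes L: "bounded_linear L" and P: "hilbert_schmidt P"
  shows "hilbert_schmidt (\<lambda>x. L (P x))"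
  using P unfolding hilbert_schmidt_def
  by (blast intro: bounded_linear_compose[OF L] summable_on_norm_sq_bounded[OF L])

lemma hilbert_schmidt_add:
  fixes P Q :: "'a::{real_inner, complete_space} \<Rightarrow> 'b::{real_inner, complete_space}"
  assumes P: "hilbert_schmidt P" and Q: "hilbert_schmidt Q"
  shows "hilbert_schmidt (\<lambda>x. P x + Q x)"
proof -
  obtain B :: "'a set" where B: "orthonormal_basis B"
    using ex_orthonormal_basis by blast
  show ?thesis
    by (rule hilbert_schmidtI[OF bounded_linear_add B summable_on_norm_sq_add])
      (use P Q B in \<open>auto intro: hilbert_schmidt_summable hilbert_schmidt_bounded_linear\<close>)
qed

text \<open>The inner product below is a sum over one fixed basis; by
  \<open>hilbert_schmidt_sum_adjoint\<close>, applied twice, the norm does not depend on the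
  choice.\<close>

definition hs_basis :: "'a::{real_inner, complete_space} set" where
  "hs_basis = (SOME B. orthonormal_basis B)"

lemma orthonormal_hs_basis: "orthonormal_basis hs_basis"
  unfolding hs_basis_def by (rule someI_ex[OF ex_orthonormal_basis])

lemma summable_hs: "(\<lambda>e. (norm (hs_apply P e))\<^sup>2) summable_on hs_basis"
  by (rule hilbert_schmidt_summable[OF hilbert_schmidt_hs_apply orthonormal_hs_basis])

instantiation hs :: ("{real_inner, complete_space}", "{real_inner, complete_space}") real_inner
begin

definition zero_hs :: "('a, 'b) hs" where "zero_hs = Hs (\<lambda>_. 0)"
definition plus_hs :: "('a, 'b) hs \<Rightarrow> ('a, 'b) hs \<Rightarrow> ('a, 'b) hs"
  where "plus_hs P Q = Hs (\<lambda>x. hs_apply P x + hs_apply Q x)"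
definition scaleR_hs :: "real \<Rightarrow> ('a, 'b) hs \<Rightarrow> ('a, 'b) hs"
  where "scaleR_hs c P = Hs (\<lambda>x. c *\<^sub>R hs_apply P x)"
definition uminus_hs :: "('a, 'b) hs \<Rightarrow> ('a, 'b) hs"
  where "uminus_hs P = (- 1) *\<^sub>R P"
definition minus_hs :: "('a, 'b) hs \<Rightarrow> ('a, 'b) hs \<Rightarrow> ('a, 'b) hs"
  where "minus_hs P Q = P + - Q"
definition inner_hs :: "('a, 'b) hs \<Rightarrow> ('a, 'b) hs \<Rightarrow> real"
  where "inner_hs P Q = (\<Sum>\<^sub>\<infinity>e\<in>hs_basis. hs_apply P e \<bullet> hs_apply Q e)"
definition norm_hs :: "('a, 'b) hs \<Rightarrow> real"
  where "norm_hs P = sqrt (P \<bullet> P)"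
definition sgn_hs :: "('a, 'b) hs \<Rightarrow> ('a, 'b) hs"
  where "sgn_hs P = inverse (norm P) *\<^sub>R P"
definition dist_hs :: "('a, 'b) hs \<Rightarrow> ('a, 'b) hs \<Rightarrow> real"
  where "dist_hs P Q = norm (P - Q)"
definition [code del]:
  "(uniformity :: (('a, 'b) hs \<times> ('a, 'b) hs) filter) =
     (INF e\<in>{0 <..}. principal {(x, y). dist x y < e})"
definition open_hs :: "('a, 'b) hs set \<Rightarrow> bool" where [code del]:
  "open_hs S = (\<forall>x\<in>S. \<forall>\<^sub>F (x', y) in uniformity. x' = x \<longrightarrow> y \<in> S)"

lemma hs_apply_zero: "hs_apply (0 :: ('a, 'b) hs) x = 0"
  by (simp add: zero_hs_def hilbert_schmidt_zero)

lemma hs_apply_add: "hs_apply (P + Q :: ('a, 'b) hs) x = hs_apply P x + hs_apply Q x"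
  by (simp add: plus_hs_def hilbert_schmidt_add hilbert_schmidt_hs_apply)

lemma hs_apply_scaleR: "hs_apply (c *\<^sub>R P :: ('a, 'b) hs) x = c *\<^sub>R hs_apply P x"
  by (simp add: scaleR_hs_def hilbert_schmidt_comp[OF bounded_linear_scaleR_right]
      hilbert_schmidt_hs_apply)

instance
proof
  fix P Q R :: "('a, 'b) hs" and c d :: real
  note simps = hs_apply_zero hs_apply_add hs_apply_scaleR
  show "P + Q + R = P + (Q + R)" by (rule hs_eqI) (simp add: simps)
  show "P + Q = Q + P" by (rule hs_eqI) (simp add: simps)
  show "0 + P = P" by (rule hs_eqI) (simp add: simps)
  show "- P + P = 0" by (rule hs_eqI) (simp add: simps uminus_hs_def)
  show "P - Q = P + - Q" by (rule minus_hs_def)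
  show "c *\<^sub>R (P + Q) = c *\<^sub>R P + c *\<^sub>R Q" by (rule hs_eqI) (simp add: simps algebra_simps)
  show "(c + d) *\<^sub>R P = c *\<^sub>R P + d *\<^sub>R P" by (rule hs_eqI) (simp add: simps algebra_simps)
  show "c *\<^sub>R d *\<^sub>R P = (c * d) *\<^sub>R P" by (rule hs_eqI) (simp add: simps)
  show "1 *\<^sub>R P = P" by (rule hs_eqI) (simp add: simps)
  show "sgn P = inverse (norm P) *\<^sub>R P" by (rule sgn_hs_def)
  show "dist P Q = norm (P - Q)" by (rule dist_hs_def)
  show "uniformity = (INF e\<in>{0 <..}. principal {(x :: ('a, 'b) hs, y). dist x y < e})"
    by (rule uniformity_hs_def)
  show "open U = (\<forall>x\<in>U. \<forall>\<^sub>F (x', y) in uniformity. x' = x \<longrightarrow> y \<in> U)" for U :: "('a, 'b) hs set"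
    by (rule open_hs_def)
  show "P \<bullet> Q = Q \<bullet> P" by (simp only: inner_hs_def inner_commute)
  show "(P + Q) \<bullet> R = P \<bullet> R + Q \<bullet> R"
    unfolding inner_hs_def
    by (simp add: simps inner_add_left infsum_add summable_on_inner summable_hs)
  show "(c *\<^sub>R P) \<bullet> Q = c * (P \<bullet> Q)"
    unfolding inner_hs_def by (simp add: simps infsum_cmult_right')
  show "0 \<le> P \<bullet> P"
    unfolding inner_hs_def by (intro infsum_nonneg) simp
  show "(P \<bullet> P = 0) = (P = 0)"
  proof
    assume "P \<bullet> P = 0"
    then have "hs_apply P e \<bullet> hs_apply P e = 0" if "e \<in> hs_basis" for e
      unfolding inner_hs_def
      by (intro nonneg_infsum_le_0D[OF _ summable_on_inner[OF summable_hs summable_hs] _ that]) auto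
    then have "hs_apply P = (\<lambda>_. 0)"
      by (intro orthonormal_basis_ext[OF orthonormal_hs_basis bounded_linear_hs_apply]) auto
    then show "P = 0" by (intro hs_eqI) (simp add: simps)
  qed (simp add: inner_hs_def simps)
  show "norm P = sqrt (P \<bullet> P)" by (rule norm_hs_def)
qed

end

lemma hs_apply_diff: "hs_apply (P - Q) x = hs_apply P x - hs_apply Q x"
  by (simp only: minus_hs_def uminus_hs_def hs_apply_add hs_apply_scaleR) simp

lemma hs_apply_minus: "hs_apply (- Q) x = - hs_apply Q x"
  by (simp only: uminus_hs_def hs_apply_scaleR) simp

lemmas hs_apply_simps [simp] =
  hs_apply_zero hs_apply_add hs_apply_scaleR hs_apply_diff hs_apply_minus

lemma hs_apply_arg [simp]:
  notes lin = bounded_linear.linear[OF bounded_linear_hs_apply]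
  shows
  "hs_apply P 0 = 0" "hs_apply P (x + y) = hs_apply P x + hs_apply P y"
  "hs_apply P (x - y) = hs_apply P x - hs_apply P y" "hs_apply P (- x) = - hs_apply P x"
  "hs_apply P (c *\<^sub>R x) = c *\<^sub>R hs_apply P x"
  by (fact linear_0[OF lin] linear_add[OF lin] linear_diff[OF lin] linear_neg[OF lin]
      linear_scale[OF lin])+

lemma has_sum_hs_inner: "((\<lambda>e. hs_apply P e \<bullet> hs_apply Q e) has_sum P \<bullet> Q) hs_basis"
  unfolding inner_hs_def by (intro has_sum_infsum summable_on_inner summable_hs)

lemma has_sum_hs_norm: "((\<lambda>e. (norm (hs_apply P e))\<^sup>2) has_sum (norm P)\<^sup>2) hs_basis"
  using has_sum_hs_inner[of P P] by (simp add: power2_norm_eq_inner)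

text \<open>\<open>norm_hs_le\<close> estimates factors on the left of an operator; taking adjoints
  brings a factor on the right into that position.\<close>

lemma norm_hs_adjoint:
  assumes "\<And>x y. hs_apply P x \<bullet> y = x \<bullet> hs_apply Q y"
  shows "norm P = norm Q"
proof -
  have "((\<lambda>e. (norm (hs_apply Q e))\<^sup>2) has_sum (norm P)\<^sup>2) hs_basis"
    by (rule hilbert_schmidt_sum_adjoint[OF orthonormal_hs_basis orthonormal_hs_basis assms
          has_sum_hs_norm])
  with has_sum_hs_norm[of Q] have "(norm P)\<^sup>2 = (norm Q)\<^sup>2"
    by (rule has_sum_unique[rotated])
  then show ?thesis by simp
qed

lemma norm_hs_le:
  assumes C: "0 \<le> C" and le: "\<And>x. norm (hs_apply P x) \<le> C * norm (hs_apply Q x)"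
  shows "norm P \<le> C * norm Q"
proof -
  have "(norm P)\<^sup>2 \<le> C\<^sup>2 * (norm Q)\<^sup>2"
  proof (rule has_sum_mono[OF has_sum_hs_norm has_sum_cmult_right[OF has_sum_hs_norm]])
    show "(norm (hs_apply P e))\<^sup>2 \<le> C\<^sup>2 * (norm (hs_apply Q e))\<^sup>2" for e
      unfolding power_mult_distrib[symmetric] by (intro power_mono le) simp
  qed
  then have "(norm P)\<^sup>2 \<le> (C * norm Q)\<^sup>2"
    by (simp add: power_mult_distrib)
  then show ?thesis
    by (rule power2_le_imp_le) (simp add: C)
qed

text \<open>Since \<open>x\<close> need not be a multiple of a basis vector, \<open>P x\<close> is
  expanded in a basis of the target instead; each coefficient is an inner product of
  \<open>x\<close> with a value of the adjoint, whose squared norms sum to the same total.\<close>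

lemma norm_hs_apply_le: "norm (hs_apply P x) \<le> norm P * norm x"
proof -
  let ?Q = "adjoint (hs_apply P)"
  note adj = inner_adjoint[OF bounded_linear_hs_apply]
  have Q: "((\<lambda>f. (norm (?Q f))\<^sup>2) has_sum (norm P)\<^sup>2) hs_basis"
    by (rule hilbert_schmidt_sum_adjoint[OF orthonormal_hs_basis orthonormal_hs_basis adj
          has_sum_hs_norm])
  have "(norm (hs_apply P x))\<^sup>2 \<le> (norm x)\<^sup>2 * (norm P)\<^sup>2"
  proof (rule has_sum_mono[OF parseval[OF orthonormal_hs_basis] has_sum_cmult_right[OF Q]])
    show "(hs_apply P x \<bullet> e)\<^sup>2 \<le> (norm x)\<^sup>2 * (norm (?Q e))\<^sup>2" for e
      using Cauchy_Schwarz_ineq[of x "?Q e"] by (simp add: adj power2_norm_eq_inner)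
  qed
  then have "(norm (hs_apply P x))\<^sup>2 \<le> (norm P * norm x)\<^sup>2"
    by (simp add: power_mult_distrib mult.commute)
  then show ?thesis by (rule power2_le_imp_le) simp
qed

lemma bounded_linear_hs_eval: "bounded_linear (\<lambda>P. hs_apply P x)"
  by (rule bounded_linear_intro[where K = "norm x"]) (simp_all add: norm_hs_apply_le)

instance hs :: ("{real_inner, complete_space}", "{real_inner, complete_space}") complete_space
proof
  fix X :: "nat \<Rightarrow> ('a, 'b) hs" assume X: "Cauchy X"
  have dist_apply: "dist (hs_apply P x) (hs_apply Q x) \<le> dist P Q * norm x" for P Q :: "('a, 'b) hs" and x
    using norm_hs_apply_le[of "P - Q" x] by (simp add: dist_norm)
  have "convergent (\<lambda>n. hs_apply (X n) x)" for x
    using bounded_linear.Cauchy[OF bounded_linear_hs_eval X] by (rule Cauchy_convergent)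
  then obtain L where L: "\<And>x. (\<lambda>n. hs_apply (X n) x) \<longlonglongrightarrow> L x"
    unfolding convergent_def by metis
  obtain K where K: "\<And>n. norm (X n) \<le> K"
    using Cauchy_Bseq[OF X] by (auto simp: Bseq_def)
  have bl: "bounded_linear L"
  proof (rule bounded_linear_intro[where K = K])
    show "L (x + y) = L x + L y" for x y
      using tendsto_add[OF L[of x] L[of y]] L[of "x + y"] by (intro LIMSEQ_unique) auto
    show "L (r *\<^sub>R x) = r *\<^sub>R L x" for r x
      using tendsto_scaleR[OF tendsto_const L[of x]] L[of "r *\<^sub>R x"] by (intro LIMSEQ_unique) auto
    show "norm (L x) \<le> norm x * K" for x
    proof (rule Lim_bounded[OF tendsto_norm[OF L]])
      show "\<forall>n\<ge>0. norm (hs_apply (X n) x) \<le> norm x * K"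
        using norm_hs_apply_le[of "X _" x] mult_right_mono[OF K norm_ge_zero[of x]]
        by (metis mult.commute order_trans)
    qed
  qed
  \<comment> \<open>A Fatou argument on finite partial sums, used with \<open>r = K + K\<close> for
    summability and with a small \<open>r\<close> for convergence.\<close>
  have tail: "(\<Sum>e\<in>G. (norm (L e - hs_apply (X n) e))\<^sup>2) \<le> r\<^sup>2"
    if G: "finite G" "G \<subseteq> hs_basis" and r: "\<And>m. m \<ge> n \<Longrightarrow> norm (X m - X n) \<le> r" for G n r
  proof (rule Lim_bounded)
    show "(\<lambda>m. \<Sum>e\<in>G. (norm (hs_apply (X m) e - hs_apply (X n) e))\<^sup>2)
        \<longlonglongrightarrow> (\<Sum>e\<in>G. (norm (L e - hs_apply (X n) e))\<^sup>2)"
      by (intro tendsto_intros L)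
    show "\<forall>m\<ge>n. (\<Sum>e\<in>G. (norm (hs_apply (X m) e - hs_apply (X n) e))\<^sup>2) \<le> r\<^sup>2"
    proof (intro allI impI)
      fix m assume "m \<ge> n"
      have "(\<Sum>e\<in>G. (norm (hs_apply (X m - X n) e))\<^sup>2) \<le> (norm (X m - X n))\<^sup>2"
        by (rule has_sum_mono2[OF has_sum_finite[OF G(1)] has_sum_hs_norm G(2)]) simp
      also have "\<dots> \<le> r\<^sup>2"
        using r[OF \<open>m \<ge> n\<close>] by (intro power_mono) auto
      finally show "(\<Sum>e\<in>G. (norm (hs_apply (X m) e - hs_apply (X n) e))\<^sup>2) \<le> r\<^sup>2"
        by simp
    qed
  qed
  have summ: "(\<lambda>e. (norm (L e - hs_apply (X n) e))\<^sup>2) summable_on hs_basis" for n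
  proof (rule nonneg_bdd_above_summable_on)
    have "norm (X m - X n) \<le> K + K" for m
      using norm_triangle_ineq4[of "X m" "X n"] K[of m] K[of n] by linarith
    then show "bdd_above (sum (\<lambda>e. (norm (L e - hs_apply (X n) e))\<^sup>2) `
        {F. F \<subseteq> hs_basis \<and> finite F})"
      using tail[of _ n "K + K"] by (intro bdd_aboveI[where M = "(K + K)\<^sup>2"]) auto
  qed simp
  \<comment> \<open>Square summability has been obtained for differences; \<open>L\<close> is
    recovered by adding \<open>X 0\<close> back.\<close>
  have "hilbert_schmidt (\<lambda>x. L x - hs_apply (X 0) x)"
    by (rule hilbert_schmidtI[OF bounded_linear_sub[OF bl bounded_linear_hs_apply]
          orthonormal_hs_basis summ])
  from hilbert_schmidt_add[OF this hilbert_schmidt_hs_apply[of "X 0"]]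
  have hs_L: "hilbert_schmidt L" by simp
  have "X \<longlonglongrightarrow> Hs L"
  proof (rule metric_LIMSEQ_I)
    fix r :: real assume r: "0 < r"
    then obtain N where N: "\<And>m n. m \<ge> N \<Longrightarrow> n \<ge> N \<Longrightarrow> dist (X m) (X n) < r / 2"
      using metric_CauchyD[OF X, of "r / 2"] by auto
    have "dist (X n) (Hs L) < r" if n: "n \<ge> N" for n
    proof -
      have "(norm (Hs L - X n))\<^sup>2 \<le> (r / 2)\<^sup>2"
      proof (rule has_sum_le_finite_sums[OF has_sum_hs_norm])
        fix G :: "'a set" assume G: "finite G" "G \<subseteq> hs_basis"
        have "norm (X m - X n) \<le> r / 2" if "m \<ge> n" for m
          using N[of m n] n that by (simp add: dist_norm)
        from tail[OF G this] show "(\<Sum>e\<in>G. (norm (hs_apply (Hs L - X n) e))\<^sup>2) \<le> (r / 2)\<^sup>2"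
          by (simp add: hs_L)
      qed
      then have "norm (Hs L - X n) \<le> r / 2"
        by (rule power2_le_imp_le) (use r in simp)
      then show ?thesis
        using r by (simp add: dist_norm norm_minus_commute)
    qed
    then show "\<exists>N. \<forall>n\<ge>N. dist (X n) (Hs L) < r" by blast
  qed
  then show "convergent X" by (auto simp: convergent_def)
qed

section \<open>Composition with bounded operators and rank one operators\<close>

definition hs_comp ::
  "('b \<Rightarrow> 'c) \<Rightarrow> ('a::{real_inner, complete_space}, 'b::{real_inner, complete_space}) hs \<Rightarrow>
    ('a, 'c::{real_inner, complete_space}) hs"
  where "hs_comp L P = Hs (\<lambda>x. L (hs_apply P x))"

lemma hs_apply_comp [simp]: "bounded_linear L \<Longrightarrow> hs_apply (hs_comp L P) x = L (hs_apply P x)"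
  by (simp add: hs_comp_def hilbert_schmidt_comp hilbert_schmidt_hs_apply)

lemma norm_hs_comp_le: "bounded_linear L \<Longrightarrow> norm (hs_comp L P) \<le> onorm L * norm P"
  by (intro norm_hs_le) (auto intro: onorm onorm_pos_le)

lemma bounded_linear_hs_comp:
  assumes L: "bounded_linear L"
  shows "bounded_linear (hs_comp L)"
proof (rule bounded_linear_intro[where K = "onorm L"])
  interpret L: bounded_linear L by fact
  show "hs_comp L (P + Q) = hs_comp L P + hs_comp L Q" for P Q
    by (rule hs_eqI) (simp add: L L.add)
  show "hs_comp L (r *\<^sub>R P) = r *\<^sub>R hs_comp L P" for r P
    by (rule hs_eqI) (simp add: L L.scaleR)
  show "norm (hs_comp L P) \<le> norm P * onorm L" for P
    using norm_hs_comp_le[OF L, of P] by (simp add: mult.commute)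
qed

definition hs_rank_one ::
  "'a \<Rightarrow> 'b \<Rightarrow> ('a::{real_inner, complete_space}, 'b::{real_inner, complete_space}) hs"
  where "hs_rank_one a b = Hs (\<lambda>x. (a \<bullet> x) *\<^sub>R b)"

lemma hs_apply_rank_one [simp]: "hs_apply (hs_rank_one a b) x = (a \<bullet> x) *\<^sub>R b"
proof -
  have "hilbert_schmidt (\<lambda>x. (a \<bullet> x) *\<^sub>R b)"
  proof (rule hilbert_schmidtI[OF _ orthonormal_hs_basis])
    show "bounded_linear (\<lambda>x. (a \<bullet> x) *\<^sub>R b)"
      by (intro bounded_linear_compose[OF bounded_linear_scaleR_left] bounded_linear_inner_right)
    show "(\<lambda>e. (norm ((a \<bullet> e) *\<^sub>R b))\<^sup>2) summable_on hs_basis"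
      using has_sum_imp_summable[OF has_sum_cmult_left[OF parseval[OF orthonormal_hs_basis, of a],
            of "(norm b)\<^sup>2"]]
      by (simp add: power_mult_distrib)
  qed
  then show ?thesis by (simp add: hs_rank_one_def)
qed

lemma hs_comp_rank_one: "bounded_linear L \<Longrightarrow> hs_comp L (hs_rank_one a b) = hs_rank_one a (L b)"
  by (rule hs_eqI) (simp add: linear_scale bounded_linear.linear)

text \<open>Pairing with rank one operators reads off matrix coefficients, which later turns a
  variational identity between operators into a pointwise one.\<close>

lemma inner_hs_rank_one: "P \<bullet> hs_rank_one a b = hs_apply P a \<bullet> b"
proof (rule has_sum_unique[OF has_sum_hs_inner])
  note adj = inner_adjoint[OF bounded_linear_hs_apply]
  show "((\<lambda>e. hs_apply P e \<bullet> hs_apply (hs_rank_one a b) e) has_sum hs_apply P a \<bullet> b) hs_basis"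
    using parseval_inner[OF orthonormal_hs_basis, of a "adjoint (hs_apply P) b"]
    by (simp add: adj inner_commute[of _ "adjoint (hs_apply P) b"])
qed

section \<open>The Lax--Milgram theorem on a closed subspace\<close>

text \<open>The unknown is a fixed point of a gradient-like step of length \<open>\<rho>\<close>,
  followed by Riesz representation in \<open>W\<close>. As it stands in the second argument of the
  form, the adjoint of \<open>L\<close> acts on it.\<close>

lemma lax_milgram_subspace:
  fixes L :: "'e::{real_inner, complete_space} \<Rightarrow> 'e"
  assumes W: "closed W" "subspace W" and L: "bounded_linear L" and f: "bounded_linear f"
    and \<omega>: "0 < \<omega>" and coercive: "\<And>Q. Q \<in> W \<Longrightarrow> \<omega> * (norm Q)\<^sup>2 \<le> L Q \<bullet> Q"
  shows "\<exists>P\<in>W. \<forall>Q\<in>W. L Q \<bullet> P = f Q"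
proof -
  obtain K0 where K0: "K0 > 0" "\<And>x. norm (L x) \<le> norm x * K0"
    using bounded_linear.pos_bounded[OF L] by blast
  \<comment> \<open>Adding \<open>\<omega>\<close> ensures \<open>\<omega> / K \<le> 1\<close>, so
    that the root defining \<open>k\<close> is that of a nonnegative number.\<close>
  define K where "K = K0 + \<omega>"
  have K: "\<omega> \<le> K" "0 < K" and LK: "norm (L x) \<le> K * norm x" for x
  proof -
    show "\<omega> \<le> K" "0 < K" using K0(1) \<omega> by (auto simp: K_def)
    have "norm (L x) \<le> norm x * K0" by (rule K0(2))
    also have "\<dots> \<le> K * norm x"
      using \<omega> by (subst mult.commute, intro mult_right_mono) (auto simp: K_def)
    finally show "norm (L x) \<le> K * norm x" .
  qed
  let ?M = "adjoint L"
  note M = inner_adjoint[OF L]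
  have MK: "norm (?M x) \<le> K * norm x" for x
  proof (cases "?M x = 0")
    case False
    have "norm (?M x) * norm (?M x) = L (?M x) \<bullet> x"
      unfolding M by (simp add: dot_square_norm power2_eq_square)
    also have "\<dots> \<le> norm (L (?M x)) * norm x" by (rule norm_cauchy_schwarz)
    also have "\<dots> \<le> K * norm (?M x) * norm x" by (intro mult_right_mono LK) simp
    finally have "norm (?M x) * norm (?M x) \<le> norm (?M x) * (K * norm x)"
      by (simp add: mult_ac)
    then show ?thesis using False by simp
  qed (use K in simp)
  \<comment> \<open>This choice minimises
    \<open>1 - 2 * \<rho> * \<omega> + \<rho>\<^sup>2 * K\<^sup>2\<close>; the minimum is
    \<open>k\<^sup>2\<close>.\<close>
  define \<rho> where "\<rho> = \<omega> / K\<^sup>2"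
  define k where "k = sqrt (1 - (\<omega> / K)\<^sup>2)"
  have \<rho>: "0 < \<rho>" using \<omega> K by (simp add: \<rho>_def)
  have "(\<omega> / K)\<^sup>2 \<le> 1"
    using K \<omega> by (intro power_le_one) auto
  then have k: "0 \<le> k" "k < 1" "k\<^sup>2 = 1 - (\<omega> / K)\<^sup>2"
    using K \<omega> by (auto simp: k_def)
  have "\<exists>u\<in>W. \<forall>Q\<in>W. P \<bullet> Q - \<rho> * (L Q \<bullet> P - f Q) = u \<bullet> Q" for P
    by (rule riesz_subspace[OF W])
      (intro bounded_linear_sub bounded_linear_const_mult f bounded_linear_inner_right
        bounded_linear_inner_left_comp L)
  then obtain \<Psi> where \<Psi>W: "\<And>P. \<Psi> P \<in> W"
    and \<Psi>: "\<And>P Q. Q \<in> W \<Longrightarrow> P \<bullet> Q - \<rho> * (L Q \<bullet> P - f Q) = \<Psi> P \<bullet> Q"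
    by metis
  have "\<exists>!P\<in>W. \<Psi> P = P"
  proof (rule Banach_fix[OF _ _ k(1,2)])
    show "complete W" using W(1) by (simp add: complete_eq_closed)
    show "W \<noteq> {}" using subspace_0[OF W(2)] by blast
    show "\<Psi> ` W \<subseteq> W" using \<Psi>W by blast
    fix P P' assume "P \<in> W" "P' \<in> W"
    define D where "D = P - P'"
    define d where "d = \<Psi> P - \<Psi> P'"
    have D: "D \<in> W" and d: "d \<in> W"
      using \<open>P \<in> W\<close> \<open>P' \<in> W\<close> \<Psi>W by (auto simp: D_def d_def intro: subspace_diff[OF W(2)])
    let ?v = "D - \<rho> *\<^sub>R ?M D"
    \<comment> \<open>Since \<open>d\<close> lies in \<open>W\<close>, it is itself an admissible
      test vector for \<open>\<Psi> P\<close> and \<open>\<Psi> P'\<close>.\<close>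
    have "d \<bullet> d = d \<bullet> ?v"
      using \<Psi>[OF d, of P, symmetric] \<Psi>[OF d, of P', symmetric]
      unfolding d_def[symmetric] inner_diff_right inner_scaleR_right M[symmetric]
      by (simp add: D_def d_def inner_diff_left inner_diff_right inner_commute algebra_simps)
    also have "\<dots> \<le> norm d * norm ?v" by (rule norm_cauchy_schwarz)
    finally have "norm d * norm d \<le> norm d * norm ?v"
      by (simp add: dot_square_norm power2_eq_square)
    then have dv: "norm d \<le> norm ?v"
      by (cases "d = 0") auto
    have DM: "\<omega> * (norm D)\<^sup>2 \<le> D \<bullet> ?M D"
      using coercive[OF D] by (simp add: M)
    have "(norm (?M D))\<^sup>2 \<le> (K * norm D)\<^sup>2"
      by (intro power_mono MK) simp
    then have MD: "(norm (?M D))\<^sup>2 \<le> K\<^sup>2 * (norm D)\<^sup>2"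
      by (simp add: power_mult_distrib)
    have "(norm ?v)\<^sup>2 = (norm D)\<^sup>2 - 2 * \<rho> * (D \<bullet> ?M D) + \<rho>\<^sup>2 * (norm (?M D))\<^sup>2"
      unfolding power2_norm_eq_inner
      by (simp add: inner_diff_left inner_diff_right inner_commute[of "?M D" D] power2_eq_square
          algebra_simps)
    also have "\<dots> \<le> (norm D)\<^sup>2 - 2 * \<rho> * (\<omega> * (norm D)\<^sup>2) + \<rho>\<^sup>2 * (K\<^sup>2 * (norm D)\<^sup>2)"
      using \<rho> by (intro add_mono diff_mono mult_left_mono DM MD order_refl) auto
    also have "\<dots> = k\<^sup>2 * (norm D)\<^sup>2"
      unfolding k(3) \<rho>_def using K by (simp add: field_simps power2_eq_square)
    finally have "(norm ?v)\<^sup>2 \<le> (k * norm D)\<^sup>2"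
      by (simp add: power_mult_distrib)
    then have "norm ?v \<le> k * norm D"
      by (rule power2_le_imp_le) (simp add: k)
    with dv show "dist (\<Psi> P) (\<Psi> P') \<le> k * dist P P'"
      by (simp add: D_def d_def dist_norm)
  qed
  then obtain P where P: "P \<in> W" "\<Psi> P = P" by blast
  have "L Q \<bullet> P = f Q" if "Q \<in> W" for Q
    using \<Psi>[OF that, of P] \<rho> P(2) by simp
  with P(1) show ?thesis by blast
qed

section \<open>The Lyapunov operator\<close>

text \<open>Symmetry is a condition in \<open>H\<close>, but the operators are kept as maps into
  \<open>V\<close>, because the form below is coercive in that norm. The extension to the dual of
  \<open>V\<close> is then the adjoint, see \<open>dual_extension_to_dual\<close>.\<close>

definition symmetric_hs ::
  "('v \<Rightarrow> 'h) \<Rightarrow> ('h::{real_inner, complete_space}, 'v::{real_inner, complete_space}) hs set"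
  where "symmetric_hs i = {P. \<forall>x y. i (hs_apply P x) \<bullet> y = x \<bullet> i (hs_apply P y)}"

lemma symmetric_hsD: "P \<in> symmetric_hs i \<Longrightarrow> i (hs_apply P x) \<bullet> y = x \<bullet> i (hs_apply P y)"
  by (simp add: symmetric_hs_def)

lemma subspace_symmetric_hs:
  assumes i: "bounded_linear i"
  shows "subspace (symmetric_hs i)"
proof -
  interpret i: bounded_linear i by fact
  show ?thesis
    by (rule subspaceI) (auto simp: symmetric_hs_def i.add i.scaleR i.zero inner_simps)
qed

lemma closed_symmetric_hs:
  assumes i: "bounded_linear i"
  shows "closed (symmetric_hs i)"
proof -
  have *: "bounded_linear (\<lambda>P. i (hs_apply P x))" for x
    using i bounded_linear_hs_eval by (rule bounded_linear_compose)
  have "closed (\<Inter>x. \<Inter>y. {P. i (hs_apply P x) \<bullet> y = x \<bullet> i (hs_apply P y)})"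
    by (intro closed_INT ballI closed_Collect_eq linear_continuous_on
        bounded_linear_inner_left_comp bounded_linear_inner_right_comp *)
  also have "(\<Inter>x. \<Inter>y. {P. i (hs_apply P x) \<bullet> y = x \<bullet> i (hs_apply P y)}) = symmetric_hs i"
    by (auto simp: symmetric_hs_def)
  finally show ?thesis .
qed

text \<open>For symmetric \<open>P\<close> this is the functional
  \<open>A\<^sup>* P x + P A x\<close> evaluated at \<open>y\<close>: the first summand comes from
  \<open>P A\<close>, whose extended \<open>P\<close> has been moved to \<open>y\<close> by
  symmetry.\<close>

definition lyapunov_form ::
  "('v \<Rightarrow> 'h) \<Rightarrow> ('v \<Rightarrow> 'v topdual) \<Rightarrow>
    ('h::{real_inner, complete_space}, 'v::{real_inner, complete_space}) hs \<Rightarrow> 'v \<Rightarrow> 'v \<Rightarrow> real"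
  where "lyapunov_form i A P x y = pairing (A x) (hs_apply P (i y)) + pairing (A y) (hs_apply P (i x))"

lemma pairing_arg [simp]:
  notes lin = bounded_linear.linear[OF bounded_linear_pairing]
  shows "pairing f (x + y) = pairing f x + pairing f y" "pairing f (x - y) = pairing f x - pairing f y"
  "pairing f (- x) = - pairing f x" "pairing f (c *\<^sub>R x) = c * pairing f x" "pairing f 0 = 0"
  by (fact linear_add[OF lin] linear_diff[OF lin] linear_neg[OF lin] linear_0[OF lin]
      linear_scale[OF lin, unfolded real_scaleR_def])+

lemma lyapunov_form_simps [simp]:
  "lyapunov_form i A 0 x y = 0"
  "lyapunov_form i A (P + Q) x y = lyapunov_form i A P x y + lyapunov_form i A Q x y"
  "lyapunov_form i A (P - Q) x y = lyapunov_form i A P x y - lyapunov_form i A Q x y"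
  "lyapunov_form i A (- P) x y = - lyapunov_form i A P x y"
  "lyapunov_form i A (c *\<^sub>R P) x y = c * lyapunov_form i A P x y"
  by (simp_all add: lyapunov_form_def algebra_simps)

locale coercive_operator =
  fixes i :: "'v::{real_inner, polish_space} \<Rightarrow> 'h::{real_inner, polish_space}"
    and A :: "'v \<Rightarrow> 'v topdual" and \<omega> :: real
  assumes triple: "gelfand_triple i" and compact: "compact_operator i"
    and A: "bounded_linear A" and \<omega>: "0 < \<omega>"
    and coercive: "\<omega> * (norm y)\<^sup>2 \<le> pairing (A y) y"
begin

lemma i: "bounded_linear i"
  using triple by (simp add: gelfand_triple_def)

lemma riesz_A: "bounded_linear (riesz \<circ> A)"
  using bounded_linear_compose[OF bounded_linear_riesz A] by (simp add: o_def)

text \<open>The product is a sum of the values \<open>pairing (A (Q e)) (Q e)\<close>, so the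
  constant of \<open>A\<close> is inherited termwise.\<close>

lemma coercive_hs: "\<omega> * (norm Q)\<^sup>2 \<le> hs_comp (riesz \<circ> A) Q \<bullet> Q"
proof (rule has_sum_mono[OF has_sum_cmult_right[OF has_sum_hs_norm] has_sum_hs_inner])
  show "\<omega> * (norm (hs_apply Q e))\<^sup>2 \<le> hs_apply (hs_comp (riesz \<circ> A) Q) e \<bullet> hs_apply Q e" for e
    using coercive[of "hs_apply Q e"] by (simp add: riesz_A pairing_riesz)
qed

text \<open>Testing with the symmetric operators \<open>(i x, \<cdot>) y + (i y, \<cdot>) x\<close> turns the variational
  equation on \<open>symmetric_hs i\<close> into the Lyapunov equation; non-symmetric right-hand sides
  are symmetrised.\<close>

lemma ex_lyapunov_solution:
  "\<exists>P\<in>symmetric_hs i. (\<forall>Q\<in>symmetric_hs i. hs_comp (riesz \<circ> A) Q \<bullet> P = 1/2 * (G \<bullet> hs_comp i Q)) \<and>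
    (\<forall>x y. lyapunov_form i A P x y = 1/2 * (hs_apply G (i x) \<bullet> i y + hs_apply G (i y) \<bullet> i x))"
proof -
  \<comment> \<open>The factor \<open>1/2\<close> is there because a symmetrised rank one test
    operator yields each term of the Lyapunov form once, but two values of \<open>G\<close>, which
    coincide for symmetric \<open>G\<close>.\<close>
  have "\<exists>P\<in>symmetric_hs i. \<forall>Q\<in>symmetric_hs i. hs_comp (riesz \<circ> A) Q \<bullet> P = 1/2 * (G \<bullet> hs_comp i Q)"
  proof (rule lax_milgram_subspace[OF closed_symmetric_hs[OF i] subspace_symmetric_hs[OF i] _ _ \<omega>])
    show "bounded_linear (hs_comp (riesz \<circ> A) :: ('h, 'v) hs \<Rightarrow> ('h, 'v) hs)"
      by (rule bounded_linear_hs_comp[OF riesz_A])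
    show "bounded_linear (\<lambda>Q. 1/2 * (G \<bullet> hs_comp i Q))"
      by (intro bounded_linear_const_mult bounded_linear_inner_right_comp bounded_linear_hs_comp i)
  qed (rule coercive_hs)
  then obtain P where P: "P \<in> symmetric_hs i"
    and eq: "\<And>Q. Q \<in> symmetric_hs i \<Longrightarrow> hs_comp (riesz \<circ> A) Q \<bullet> P = 1/2 * (G \<bullet> hs_comp i Q)"
    by blast
  have "lyapunov_form i A P x y = 1/2 * (hs_apply G (i x) \<bullet> i y + hs_apply G (i y) \<bullet> i x)" for x y
  proof -
    let ?Q = "hs_rank_one (i x) y + hs_rank_one (i y) x"
    have "?Q \<in> symmetric_hs i"
      unfolding symmetric_hs_def
      by (simp add: bounded_linear.linear[OF i] linear_add linear_scale inner_simps inner_commute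
          algebra_simps)
    from eq[OF this] show ?thesis
      by (simp add: linear_add[OF bounded_linear.linear[OF bounded_linear_hs_comp]] hs_comp_rank_one
          riesz_A i inner_add_left inner_add_right inner_hs_rank_one inner_commute[of _ P] pairing_riesz lyapunov_form_def
          inner_commute[of "riesz _"])
  qed
  with P eq show ?thesis by blast
qed

text \<open>Coercivity makes the variational solution unique in the symmetric subspace, hence the
  chosen solution linear in \<open>G\<close>; testing with the solution itself bounds it.\<close>

lemma ex_lyapunov_operator:
  "\<exists>T. bounded_linear T \<and> (\<forall>G. T G \<in> symmetric_hs i) \<and>
    (\<forall>G x y. lyapunov_form i A (T G) x y = 1/2 * (hs_apply G (i x) \<bullet> i y + hs_apply G (i y) \<bullet> i x))"
proof -
  let ?L = "hs_comp (riesz \<circ> A) :: ('h, 'v) hs \<Rightarrow> ('h, 'v) hs"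
  note W = subspace_symmetric_hs[OF i]
  obtain T where TW: "\<And>G. T G \<in> symmetric_hs i"
    and eq: "\<And>G Q. Q \<in> symmetric_hs i \<Longrightarrow> ?L Q \<bullet> T G = 1/2 * (G \<bullet> hs_comp i Q)"
    and lyap: "\<And>G x y. lyapunov_form i A (T G) x y
        = 1/2 * (hs_apply G (i x) \<bullet> i y + hs_apply G (i y) \<bullet> i x)"
    using ex_lyapunov_solution by metis
  have zero: "Q = 0" if "?L Q \<bullet> Q = 0" for Q
    using coercive_hs[of Q] that \<omega> by (simp add: mult_le_0_iff)
  have "bounded_linear T"
  proof (rule bounded_linear_intro[where K = "onorm i / \<omega>"])
    show "T (G + G') = T G + T G'" for G G'
    proof -
      have "T (G + G') - (T G + T G') \<in> symmetric_hs i"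
        by (intro subspace_diff subspace_add W TW)
      note eq = eq[OF this]
      have "T (G + G') - (T G + T G') = 0"
        by (rule zero, unfold inner_diff_right inner_add_right eq) (simp add: inner_add_left)
      then show ?thesis by simp
    qed
    show "T (r *\<^sub>R G) = r *\<^sub>R T G" for r G
    proof -
      have "T (r *\<^sub>R G) - r *\<^sub>R T G \<in> symmetric_hs i"
        by (intro subspace_diff subspace_scale W TW)
      note eq = eq[OF this]
      have "T (r *\<^sub>R G) - r *\<^sub>R T G = 0"
        by (rule zero, unfold inner_diff_right inner_scaleR_right eq) simp
      then show ?thesis by simp
    qed
    show "norm (T G) \<le> norm G * (onorm i / \<omega>)" for G
    proof (cases "T G = 0")
      case False
      have "\<omega> * (norm (T G))\<^sup>2 \<le> 1/2 * (G \<bullet> hs_comp i (T G))"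
        using coercive_hs[of "T G"] unfolding eq[OF TW] .
      moreover have "0 \<le> \<omega> * (norm (T G))\<^sup>2"
        using \<omega> by simp
      ultimately have "\<omega> * (norm (T G))\<^sup>2 \<le> G \<bullet> hs_comp i (T G)"
        by linarith
      also have "\<dots> \<le> norm G * norm (hs_comp i (T G))"
        by (rule norm_cauchy_schwarz)
      also have "\<dots> \<le> norm G * (onorm i * norm (T G))"
        by (intro mult_left_mono norm_hs_comp_le i) simp
      finally have "\<omega> * norm (T G) * norm (T G) \<le> (norm G * onorm i) * norm (T G)"
        by (simp add: power2_eq_square mult_ac)
      then have "\<omega> * norm (T G) \<le> norm G * onorm i"
        using False by simp
      then show ?thesis
        using \<omega> by (simp add: field_simps)
    qed (use \<omega> onorm_pos_le[OF i] in simp)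
  qed
  with TW lyap show ?thesis by blast
qed

end

section \<open>A continuation principle for quadratic equations\<close>

text \<open>\<open>S\<close> will invert a linearised operator and \<open>h\<close> collect the
  remaining terms; \<open>C\<close> bounds the first, and the remainder has to be small enough for
  the product to be at most \<open>1/2\<close>.\<close>

lemma contraction_zero:
  fixes S :: "'e::{real_normed_vector, complete_space} \<Rightarrow> 'e"
  assumes "closed B" "B \<noteq> {}"
    and maps: "\<And>D. D \<in> B \<Longrightarrow> S (h D) \<in> B"
    and C: "0 \<le> C" and S: "\<And>D D'. D \<in> B \<Longrightarrow> D' \<in> B \<Longrightarrow> norm (S (h D) - S (h D')) \<le> C * norm (h D - h D')"
    and h: "\<And>D D'. D \<in> B \<Longrightarrow> D' \<in> B \<Longrightarrow> C * norm (h D - h D') \<le> 1/2 * norm (D - D')"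
  shows "\<exists>D\<in>B. S (h D) = D"
proof -
  have "\<exists>!D\<in>B. S (h D) = D"
  proof (rule Banach_fix[where c = "1/2"])
    show "complete B" using \<open>closed B\<close> by (simp add: complete_eq_closed)
    show "(\<lambda>D. S (h D)) ` B \<subseteq> B" using maps by blast
    fix D D' assume "D \<in> B" "D' \<in> B"
    then show "dist (S (h D)) (S (h D')) \<le> 1/2 * dist D D'"
      unfolding dist_norm using S h order_trans by blast
  qed (use assms in auto)
  then show ?thesis by blast
qed

text \<open>Along \<open>P + t \<beta>(P, P) = f\<close> both the solution and the solvability of the linearised equation
  are carried from \<open>t\<close> to \<open>t + \<delta>\<close> by contractions; the a priori bounds make \<open>\<delta>\<close> uniform, so that
  finitely many steps suffice.\<close>

lemma quadratic_continuation:
  fixes \<beta> :: "'e \<Rightarrow> 'e \<Rightarrow> 'e::{real_normed_vector, complete_space}"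
  assumes W: "closed W" "subspace W" and \<beta>: "bounded_bilinear \<beta>"
    and \<beta>W: "\<And>P Q. P \<in> W \<Longrightarrow> Q \<in> W \<Longrightarrow> \<beta> P Q \<in> W" and fW: "f \<in> W" and Nf: "N f"
    and bound: "\<And>t P. 0 \<le> t \<Longrightarrow> t \<le> 1 \<Longrightarrow> P \<in> W \<Longrightarrow> N P \<Longrightarrow> P + t *\<^sub>R \<beta> P P = f \<Longrightarrow> norm P \<le> M"
    and stable: "\<And>t P D. 0 \<le> t \<Longrightarrow> t \<le> 1 \<Longrightarrow> P \<in> W \<Longrightarrow> N P \<Longrightarrow> P + t *\<^sub>R \<beta> P P = f \<Longrightarrow> D \<in> W \<Longrightarrow>
      norm D \<le> C * norm (D + t *\<^sub>R (\<beta> P D + \<beta> D P))"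
    and \<eta>: "0 < \<eta>"
    and persist: "\<And>t P Q. 0 \<le> t \<Longrightarrow> t \<le> 1 \<Longrightarrow> P \<in> W \<Longrightarrow> P + t *\<^sub>R \<beta> P P = f \<Longrightarrow> Q \<in> W \<Longrightarrow> N Q \<Longrightarrow>
      norm (P - Q) \<le> \<eta> \<Longrightarrow> N P"
  shows "\<exists>P\<in>W. N P \<and> P + \<beta> P P = f"
proof -
  interpret \<beta>: bounded_bilinear \<beta> by fact
  note \<beta>_simps = \<beta>.add_left \<beta>.add_right \<beta>.diff_left \<beta>.diff_right
  note W_intros = subspace_add[OF W(2)] subspace_diff[OF W(2)] subspace_scale[OF W(2)]
    subspace_neg[OF W(2)] \<beta>W
  obtain b where b: "b > 0" and \<beta>_le: "\<And>x y. norm (\<beta> x y) \<le> norm x * norm y * b"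
    using \<beta>.pos_bounded by blast
  define M' where "M' = max M 1"
  define C' where "C' = max C 1"
  have M': "1 \<le> M'" and C': "1 \<le> C'" by (auto simp: M'_def C'_def)
  have bound': "norm P \<le> M'" if "0 \<le> t" "t \<le> 1" "P \<in> W" "N P" "P + t *\<^sub>R \<beta> P P = f" for t P
    using bound[OF that] by (simp add: M'_def)
  have stable': "norm D \<le> C' * norm (D + t *\<^sub>R (\<beta> P D + \<beta> D P))"
    if "0 \<le> t" "t \<le> 1" "P \<in> W" "N P" "P + t *\<^sub>R \<beta> P P = f" "D \<in> W" for t P D
    using stable[OF that] mult_right_mono[of C C' "norm (D + t *\<^sub>R (\<beta> P D + \<beta> D P))"]
    by (simp add: C'_def)
  \<comment> \<open>Radius of the ball for the increment: \<open>\<eta>\<close> is what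
    \<open>persist\<close> tolerates, the other bound makes the terms of second order contribute
    little.\<close>
  define r where "r = min \<eta> (1 / (8 * C' * b))"
  have r: "0 < r" "r \<le> \<eta>" "C' * b * r \<le> 1/8"
  proof -
    show "0 < r" "r \<le> \<eta>" using \<eta> C' b by (auto simp: r_def)
    have "C' * b * r \<le> C' * b * (1 / (8 * C' * b))"
      using C' b by (intro mult_left_mono) (auto simp: r_def)
    then show "C' * b * r \<le> 1/8" using C' b by simp
  qed
  \<comment> \<open>A common majorant of the coefficients of \<open>\<delta>\<close> in the self-map
    estimate and in both Lipschitz estimates.\<close>
  define X where "X = C' * b * (M' + r) * (M' + 2 * r)"
  have X: "0 < X" using C' b M' r by (simp add: X_def add_pos_pos)
  \<comment> \<open>The first bound keeps the ball invariant, as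
    \<open>r / 2 + r / 8 \<le> r\<close>; the second gives the contraction constant
    \<open>2/8 + 2/8\<close>.\<close>
  define \<delta>0 where "\<delta>0 = min (r / (2 * X)) (1 / (8 * X))"
  have \<delta>0: "0 < \<delta>0" "\<delta>0 * X \<le> r / 2" "\<delta>0 * X \<le> 1/8"
  proof -
    show "0 < \<delta>0" using X r by (simp add: \<delta>0_def)
    have "\<delta>0 \<le> r / (2 * X)" "\<delta>0 \<le> 1 / (8 * X)"
      by (simp_all add: \<delta>0_def)
    then have "\<delta>0 * X \<le> r / (2 * X) * X" "\<delta>0 * X \<le> 1 / (8 * X) * X"
      using X by (auto simp del: times_divide_eq_left intro!: mult_right_mono)
    then show "\<delta>0 * X \<le> r / 2" "\<delta>0 * X \<le> 1/8" using X by simp_all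
  qed
  \<comment> \<open>Solvability of the linearised equation is part of the induction, since
    \<open>stable\<close> gives only injectivity with a bound on the inverse.\<close>
  define J where "J t \<longleftrightarrow> (\<exists>P\<in>W. N P \<and> P + t *\<^sub>R \<beta> P P = f \<and>
      (\<forall>g\<in>W. \<exists>D\<in>W. D + t *\<^sub>R (\<beta> P D + \<beta> D P) = g))" for t
  have step: "J s" if J: "J t" and t: "0 \<le> t" "t \<le> s" "s \<le> 1" "s - t \<le> \<delta>0" for t s
  proof -
    define \<delta> where "\<delta> = s - t"
    have s: "s = t + \<delta>" and \<delta>: "0 \<le> \<delta>" using t by (auto simp: \<delta>_def)
    have t1: "t \<le> 1" and s0: "0 \<le> s" using t by auto
    have \<delta>X: "\<delta> * X \<le> r / 2" "\<delta> * X \<le> 1/8"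
      using \<delta>0 mult_right_mono[of \<delta> \<delta>0 X] X t(4) unfolding \<delta>_def[symmetric] by linarith+
    obtain P where P: "P \<in> W" "N P" "P + t *\<^sub>R \<beta> P P = f"
      and "\<forall>g\<in>W. \<exists>D\<in>W. D + t *\<^sub>R (\<beta> P D + \<beta> D P) = g"
      using J by (auto simp: J_def)
    then obtain S where SW: "\<And>g. g \<in> W \<Longrightarrow> S g \<in> W"
      and S: "\<And>g. g \<in> W \<Longrightarrow> S g + t *\<^sub>R (\<beta> P (S g) + \<beta> (S g) P) = g"
      by metis
    have S_le: "norm (S g) \<le> C' * norm g" if "g \<in> W" for g
      using stable'[OF t(1) t1 P SW[OF that]] S[OF that] by simp
    have S_lip: "norm (S g - S g') \<le> C' * norm (g - g')" if "g \<in> W" "g' \<in> W" for g g'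
    proof -
      have "S g - S g' + t *\<^sub>R (\<beta> P (S g - S g') + \<beta> (S g - S g') P)
          = (S g + t *\<^sub>R (\<beta> P (S g) + \<beta> (S g) P)) - (S g' + t *\<^sub>R (\<beta> P (S g') + \<beta> (S g') P))"
        by (simp add: \<beta>_simps algebra_simps)
      also have "\<dots> = g - g'" by (simp only: S that)
      finally show ?thesis
        using stable'[OF t(1) t1 P subspace_diff[OF W(2) SW[OF that(1)] SW[OF that(2)]]] by simp
    qed
    have P_le: "norm P \<le> M'" by (rule bound'[OF t(1) t1 P])
    \<comment> \<open>With \<open>P + D\<close> in place of \<open>P\<close>, the equation at
      \<open>s\<close> minus the one at \<open>t\<close> reads
      \<open>D + t *\<^sub>R (\<beta> P D + \<beta> D P) = h D\<close>.\<close>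
    define h where "h D = - (\<delta> *\<^sub>R \<beta> P P + \<delta> *\<^sub>R (\<beta> P D + \<beta> D P) + s *\<^sub>R \<beta> D D)" for D
    have hW: "h D \<in> W" if "D \<in> W" for D
      unfolding h_def using P(1) that by (intro W_intros)
    let ?B = "W \<inter> cball 0 r"
    have \<beta>2: "norm (\<beta> x y) \<le> x' * y' * b" if "norm x \<le> x'" "norm y \<le> y'" for x y x' y'
      using \<beta>_le[of x y] mult_mono[OF that] b order_trans[OF norm_ge_zero that(1)]
      by (meson mult_right_mono norm_ge_zero order_trans less_imp_le)
    have "\<exists>D\<in>?B. S (h D) = D"
    proof (rule contraction_zero[where C = C' and S = S and h = h])
      show "closed ?B" using W(1) by (intro closed_Int closed_cball)
      show "?B \<noteq> {}" using subspace_0[OF W(2)] r(1) by force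
      show "0 \<le> C'" using C' by simp
    next
      fix D assume D: "D \<in> ?B"
      then have D': "D \<in> W" "norm D \<le> r" by auto
      have "norm (h D) \<le> norm (\<delta> *\<^sub>R \<beta> P P) + (norm (\<delta> *\<^sub>R \<beta> P D) + norm (\<delta> *\<^sub>R \<beta> D P))
          + norm (s *\<^sub>R \<beta> D D)"
        unfolding h_def norm_minus_cancel scaleR_add_right by (intro norm_triangle_le add_mono order_refl)
      also have "\<dots> \<le> \<delta> * (M' * M' * b) + (\<delta> * (M' * r * b) + \<delta> * (r * M' * b)) + 1 * (r * r * b)"
        unfolding norm_scaleR using \<delta> s0 t(3) b r
        by (intro add_mono mult_mono \<beta>2 P_le D') auto
      finally have "C' * norm (h D)
          \<le> C' * (\<delta> * (M' * M' * b) + (\<delta> * (M' * r * b) + \<delta> * (r * M' * b)) + 1 * (r * r * b))"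
        using C' by (intro mult_left_mono) auto
      also have "\<dots> = \<delta> * (C' * b * M' * (M' + 2 * r)) + (C' * b * r) * r"
        by (simp add: algebra_simps)
      also have "\<dots> \<le> \<delta> * X + 1/8 * r"
        unfolding X_def using \<delta> C' b M' r by (intro add_mono mult_left_mono mult_right_mono) auto
      also have "\<dots> \<le> r" using \<delta>X r(1) by simp
      finally show "S (h D) \<in> ?B"
        using S_le[OF hW[OF D'(1)]] SW[OF hW[OF D'(1)]] by simp
    next
      fix D E assume D: "D \<in> ?B" "E \<in> ?B"
      then have D': "D \<in> W" "norm D \<le> r" "E \<in> W" "norm E \<le> r" by auto
      show "norm (S (h D) - S (h E)) \<le> C' * norm (h D - h E)"
        using S_lip hW D' by blast
      let ?n = "norm (D - E)"
      have "h D - h E = - (\<delta> *\<^sub>R \<beta> P (D - E) + \<delta> *\<^sub>R \<beta> (D - E) P + (s *\<^sub>R \<beta> D (D - E) + s *\<^sub>R \<beta> (D - E) E))"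
        by (simp add: h_def \<beta>_simps algebra_simps)
      then have "norm (h D - h E) \<le> (norm (\<delta> *\<^sub>R \<beta> P (D - E)) + norm (\<delta> *\<^sub>R \<beta> (D - E) P))
          + (norm (s *\<^sub>R \<beta> D (D - E)) + norm (s *\<^sub>R \<beta> (D - E) E))"
        by (simp only: norm_minus_cancel) (intro norm_triangle_le add_mono order_refl)
      also have "\<dots> \<le> (\<delta> * (M' * ?n * b) + \<delta> * (?n * M' * b)) + (1 * (r * ?n * b) + 1 * (?n * r * b))"
        unfolding norm_scaleR using \<delta> s0 t(3) b r
        by (intro add_mono mult_mono \<beta>2 P_le D') auto
      finally have "C' * norm (h D - h E)
          \<le> C' * ((\<delta> * (M' * ?n * b) + \<delta> * (?n * M' * b)) + (1 * (r * ?n * b) + 1 * (?n * r * b)))"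
        using C' by (intro mult_left_mono) auto
      also have "\<dots> = (2 * (\<delta> * (C' * b * M' * 1)) + 2 * (C' * b * r)) * ?n"
        by (simp add: algebra_simps)
      also have "\<dots> \<le> (2 * (\<delta> * X) + 2 * (1/8)) * ?n"
        unfolding X_def using \<delta> C' b M' r
        by (intro add_mono mult_left_mono mult_right_mono mult_mono) auto
      also have "\<dots> \<le> 1/2 * ?n"
        using \<delta>X by (intro mult_right_mono) auto
      finally show "C' * norm (h D - h E) \<le> 1/2 * ?n" .
    qed
    then obtain D where D: "D \<in> W" "norm D \<le> r" and SD: "S (h D) = D" by auto
    define P' where "P' = P + D"
    have P'W: "P' \<in> W" using P D by (simp add: P'_def subspace_add[OF W(2)])
    have "D + t *\<^sub>R (\<beta> P D + \<beta> D P) = h D"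
      using S[OF hW[OF D(1)]] SD by simp
    then have "(P + t *\<^sub>R \<beta> P P) + (D + t *\<^sub>R (\<beta> P D + \<beta> D P)) - h D = f"
      using P(3) by simp
    then have P'f: "P' + s *\<^sub>R \<beta> P' P' = f"
      by (simp add: P'_def h_def s \<beta>_simps algebra_simps)
    have NP': "N P'"
      by (rule persist[OF s0 t(3) P'W P'f P(1,2)]) (use D r in \<open>simp add: P'_def\<close>)
    have P'_le: "norm P' \<le> M' + r"
      using norm_triangle_ineq[of P D] P_le D by (simp add: P'_def)
    have "\<exists>D'\<in>W. D' + s *\<^sub>R (\<beta> P' D' + \<beta> D' P') = g" if g: "g \<in> W" for g
    proof -
      \<comment> \<open>The linearisation at \<open>(s, P')\<close> is that at
        \<open>(t, P)\<close>, inverted by \<open>S\<close>, plus the small terms subtracted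
        here.\<close>
      define k where "k D' = g - (\<delta> *\<^sub>R \<beta> P' D' + \<delta> *\<^sub>R \<beta> D' P' + (t *\<^sub>R \<beta> D D' + t *\<^sub>R \<beta> D' D))" for D'
      have kW: "k D' \<in> W" if "D' \<in> W" for D'
        unfolding k_def using P'W D g that by (intro W_intros)
      have "\<exists>D'\<in>W. S (k D') = D'"
      proof (rule contraction_zero[where C = C' and S = S and h = k])
        show "W \<noteq> {}" using subspace_0[OF W(2)] by blast
        show "0 \<le> C'" using C' by simp
        show "S (k D') \<in> W" if "D' \<in> W" for D' using SW kW that by blast
        fix F E assume FE: "F \<in> W" "E \<in> W"
        show "norm (S (k F) - S (k E)) \<le> C' * norm (k F - k E)"
          using S_lip kW FE by blast
        let ?n = "norm (F - E)"
        have "k F - k E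
            = - ((\<delta> *\<^sub>R \<beta> P' (F - E) + \<delta> *\<^sub>R \<beta> (F - E) P') + (t *\<^sub>R \<beta> D (F - E) + t *\<^sub>R \<beta> (F - E) D))"
          by (simp add: k_def \<beta>_simps algebra_simps)
        then have "norm (k F - k E) \<le> (norm (\<delta> *\<^sub>R \<beta> P' (F - E)) + norm (\<delta> *\<^sub>R \<beta> (F - E) P'))
            + (norm (t *\<^sub>R \<beta> D (F - E)) + norm (t *\<^sub>R \<beta> (F - E) D))"
          by (simp only: norm_minus_cancel) (intro norm_triangle_le add_mono order_refl)
        also have "\<dots> \<le> (\<delta> * ((M' + r) * ?n * b) + \<delta> * (?n * (M' + r) * b))
            + (1 * (r * ?n * b) + 1 * (?n * r * b))"
          unfolding norm_scaleR using \<delta> t(1) t1 b r M'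
          by (intro add_mono mult_mono \<beta>2 P'_le D) auto
        finally have "C' * norm (k F - k E)
            \<le> C' * ((\<delta> * ((M' + r) * ?n * b) + \<delta> * (?n * (M' + r) * b)) + (1 * (r * ?n * b) + 1 * (?n * r * b)))"
          using C' by (intro mult_left_mono) auto
        also have "\<dots> = (2 * (\<delta> * (C' * b * (M' + r) * 1)) + 2 * (C' * b * r)) * ?n"
          by (simp add: algebra_simps)
        also have "\<dots> \<le> (2 * (\<delta> * X) + 2 * (1/8)) * ?n"
          unfolding X_def using \<delta> C' b M' r
          by (intro add_mono mult_left_mono mult_right_mono mult_mono) auto
        also have "\<dots> \<le> 1/2 * ?n"
          using \<delta>X by (intro mult_right_mono) auto
        finally show "C' * norm (k F - k E) \<le> 1/2 * ?n" .
      qed (fact W(1))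
      then obtain D' where D': "D' \<in> W" "S (k D') = D'" by blast
      have "D' + t *\<^sub>R (\<beta> P D' + \<beta> D' P) = k D'"
        using S[OF kW[OF D'(1)]] D'(2) by simp
      then have "D' + s *\<^sub>R (\<beta> P' D' + \<beta> D' P') = g"
        by (simp add: k_def P'_def s \<beta>_simps algebra_simps)
      with D'(1) show ?thesis by blast
    qed
    then show "J s"
      unfolding J_def using P'W NP' P'f by blast
  qed
  \<comment> \<open>At the start the solution is \<open>f\<close> and the linearised operator is the
    identity; the cap at \<open>1\<close> shortens the last step.\<close>
  have "J (min 1 (real n * \<delta>0))" for n
  proof (induction n)
    case 0
    show ?case
      using fW Nf by (auto simp: J_def intro!: bexI[of _ f])
  next
    case (Suc n)
    show ?case
      by (rule step[OF Suc.IH]) (use \<delta>0(1) in \<open>auto simp: min_def algebra_simps\<close>)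
  qed
  moreover obtain n where "1 \<le> real n * \<delta>0"
    using reals_Archimedean3[OF \<delta>0(1)] less_imp_le by blast
  ultimately have "J 1" by (metis min.absorb1)
  then show ?thesis by (auto simp: J_def)
qed

section \<open>Symmetric compact operators\<close>

text \<open>Polarisation: for symmetric operators a bound on the quadratic form is a bound on the
  operator norm.\<close>

lemma norm_le_of_form_bound:
  fixes T :: "'h::real_inner \<Rightarrow> 'h"
  assumes T: "linear T" and sym: "\<And>x y. T x \<bullet> y = x \<bullet> T y"
    and form: "\<And>y. \<bar>T y \<bullet> y\<bar> \<le> \<kappa> * (norm y)\<^sup>2"
  shows "norm (T y) \<le> \<kappa> * norm y"
proof (cases "T y = 0 \<or> y = 0")
  case True
  moreover have "0 \<le> \<kappa> * (norm y)\<^sup>2"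
    using form[of y] abs_ge_zero[of "T y \<bullet> y"] by linarith
  then have "0 \<le> \<kappa> * norm y"
    by (cases "y = 0") (auto simp: zero_le_mult_iff)
  ultimately show ?thesis using linear_0[OF T] by auto
next
  case False
  \<comment> \<open>Rescaling \<open>T y\<close> to the length of \<open>y\<close> balances the two
    terms of the parallelogram identity.\<close>
  define w where "w = (norm y / norm (T y)) *\<^sub>R T y"
  have w: "norm w = norm y" "T y \<bullet> w = norm y * norm (T y)"
    using False by (simp_all add: w_def dot_square_norm power2_eq_square)
  have "4 * (T y \<bullet> w) = T (y + w) \<bullet> (y + w) - T (y - w) \<bullet> (y - w)"
    using sym[of w y]
    by (simp add: linear_add[OF T] linear_diff[OF T] inner_simps inner_commute)
  also have "\<dots> \<le> \<kappa> * (norm (y + w))\<^sup>2 + \<kappa> * (norm (y - w))\<^sup>2"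
    using form[of "y + w"] form[of "y - w"] by linarith
  also have "\<dots> = \<kappa> * (2 * (norm y)\<^sup>2 + 2 * (norm w)\<^sup>2)"
    by (simp add: power2_norm_eq_inner inner_simps inner_commute algebra_simps)
  also have "\<dots> = 4 * (norm y * (\<kappa> * norm y))"
    by (simp add: w power2_eq_square)
  finally have "norm y * norm (T y) \<le> norm y * (\<kappa> * norm y)"
    by (simp add: w)
  then show ?thesis using False by simp
qed

text \<open>The form is evaluated at \<open>x - (1/K) *\<^sub>R M x\<close>. It follows that along
  bounded vectors whose form values tend to zero, the images under \<open>M\<close> tend to zero as
  well.\<close>

lemma norm_sq_le_nonneg_form:
  fixes M :: "'h::real_inner \<Rightarrow> 'h"
  assumes M: "linear M" and sym: "\<And>x y. M x \<bullet> y = x \<bullet> M y" and pos: "\<And>x. 0 \<le> M x \<bullet> x"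
    and K: "0 < K" "\<And>x. norm (M x) \<le> K * norm x"
  shows "(norm (M x))\<^sup>2 \<le> K * (M x \<bullet> x)"
proof -
  have "0 \<le> M (x - (1/K) *\<^sub>R M x) \<bullet> (x - (1/K) *\<^sub>R M x)" by (rule pos)
  also have "\<dots> = M x \<bullet> x - 2/K * (norm (M x))\<^sup>2 + (1/K)\<^sup>2 * (M (M x) \<bullet> M x)"
    using sym[of "M x" x]
    by (simp add: linear_diff[OF M] linear_scale[OF M] inner_diff_left inner_diff_right
        dot_square_norm inner_commute power2_eq_square algebra_simps)
  also have "\<dots> \<le> M x \<bullet> x - 2/K * (norm (M x))\<^sup>2 + (1/K)\<^sup>2 * (K * (norm (M x))\<^sup>2)"
  proof (intro add_mono order_refl mult_left_mono)
    have "M (M x) \<bullet> M x \<le> norm (M (M x)) * norm (M x)" by (rule norm_cauchy_schwarz)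
    also have "\<dots> \<le> K * norm (M x) * norm (M x)" by (intro mult_right_mono K) simp
    finally show "M (M x) \<bullet> M x \<le> K * (norm (M x))\<^sup>2" by (simp add: power2_eq_square)
  qed simp
  also have "\<dots> = M x \<bullet> x - (norm (M x))\<^sup>2 / K"
    using K by (simp add: power2_eq_square field_simps)
  finally show ?thesis using K by (simp add: field_simps)
qed

text \<open>\<open>\<nu>\<close> is the supremum of \<open>(D y, y) / (X y, y)\<close>; along a maximising sequence the nonnegative
  operator \<open>\<nu> X - D\<close> tends to zero, so compactness of \<open>D\<close> and coercivity of \<open>X\<close> give a limit.\<close>

lemma generalized_eigenvector:
  fixes D X :: "'h::{real_inner, complete_space} \<Rightarrow> 'h"
  assumes D: "compact_operator D" "\<And>x y. D x \<bullet> y = x \<bullet> D y"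
    and X: "bounded_linear X" "\<And>x y. X x \<bullet> y = x \<bullet> X y"
    and \<epsilon>: "0 < \<epsilon>" "\<And>x. \<epsilon> * (norm x)\<^sup>2 \<le> X x \<bullet> x"
    and pos: "0 < D y0 \<bullet> y0"
  shows "\<exists>\<nu>>0. \<exists>x. x \<noteq> 0 \<and> D x = \<nu> *\<^sub>R X x \<and> (\<forall>y. D y \<bullet> y \<le> \<nu> * (X y \<bullet> y))"
proof -
  have Dbl: "bounded_linear D" using D(1) by (simp add: compact_operator_def)
  note linD = bounded_linear.linear[OF Dbl] and linX = bounded_linear.linear[OF X(1)]
  have Xpos: "0 < X y \<bullet> y" if "y \<noteq> 0" for y
    using \<epsilon>(2)[of y] \<epsilon>(1) that by (smt (verit) mult_pos_pos zero_less_norm_iff zero_less_power)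
  define S where "S = (\<lambda>y. (D y \<bullet> y) / (X y \<bullet> y)) ` (- {0})"
  define \<nu> where "\<nu> = Sup S"
  have y0: "y0 \<noteq> 0" using pos linear_0[OF linD] by auto
  have "(D y \<bullet> y) / (X y \<bullet> y) \<le> onorm D / \<epsilon>" if "y \<noteq> 0" for y
  proof -
    have "D y \<bullet> y \<le> norm (D y) * norm y" by (rule norm_cauchy_schwarz)
    also have "\<dots> \<le> onorm D * norm y * norm y" by (intro mult_right_mono onorm Dbl) simp
    also have "\<dots> = onorm D / \<epsilon> * (\<epsilon> * (norm y)\<^sup>2)" using \<epsilon>(1) by (simp add: power2_eq_square)
    also have "\<dots> \<le> onorm D / \<epsilon> * (X y \<bullet> y)"
      using \<epsilon> onorm_pos_le[OF Dbl] by (intro mult_left_mono) auto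
    finally show ?thesis using Xpos[OF that] by (simp add: pos_divide_le_eq)
  qed
  then have bdd: "bdd_above S" by (auto simp: S_def intro!: bdd_aboveI)
  have S0: "S \<noteq> {}" using y0 by (auto simp: S_def)
  have "(D y0 \<bullet> y0) / (X y0 \<bullet> y0) \<le> \<nu>"
    unfolding \<nu>_def using y0 bdd by (intro cSup_upper) (auto simp: S_def)
  then have \<nu>: "0 < \<nu>"
    using pos Xpos[OF y0] by (smt (verit) divide_pos_pos)
  have form: "D y \<bullet> y \<le> \<nu> * (X y \<bullet> y)" for y
  proof (cases "y = 0")
    case False
    then have "(D y \<bullet> y) / (X y \<bullet> y) \<le> \<nu>"
      unfolding \<nu>_def using bdd by (intro cSup_upper) (auto simp: S_def)
    then show ?thesis using Xpos[OF False] by (simp add: pos_divide_le_eq)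
  qed (simp add: linear_0[OF linD])
  \<comment> \<open>\<open>M\<close> is nonnegative by \<open>form\<close>, and its kernel consists
    of the vectors sought.\<close>
  define M where "M y = \<nu> *\<^sub>R X y - D y" for y
  have Mbl: "bounded_linear M"
    unfolding M_def by (intro bounded_linear_sub bounded_linear_const_scaleR X Dbl)
  obtain K where K: "0 < K" "\<And>x. norm (M x) \<le> K * norm x"
    using bounded_linear.pos_bounded[OF Mbl] by (metis mult.commute)
  obtain KX where KX: "0 < KX" "\<And>x. norm (X x) \<le> KX * norm x"
    using bounded_linear.pos_bounded[OF X(1)] by (metis mult.commute)
  have M_le: "(norm (M x))\<^sup>2 \<le> K * (M x \<bullet> x)" for x
    by (rule norm_sq_le_nonneg_form[OF bounded_linear.linear[OF Mbl] _ _ K])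
      (use form in \<open>auto simp: M_def inner_diff_left inner_diff_right D X\<close>)
  have "\<exists>x. norm x = 1 \<and> M x \<bullet> x \<le> KX * inverse (real (Suc n))" for n
  proof -
    have "\<nu> - inverse (real (Suc n)) < Sup S" by (simp add: \<nu>_def)
    then obtain y where y: "y \<noteq> 0" "\<nu> - inverse (real (Suc n)) < (D y \<bullet> y) / (X y \<bullet> y)"
      using less_cSup_iff[OF S0 bdd] by (auto simp: S_def)
    \<comment> \<open>The quotient is homogeneous of degree zero, so a maximising sequence may be
      taken on the unit sphere, where \<open>X x \<bullet> x\<close> is at most
      \<open>KX\<close>.\<close>
    define x where "x = inverse (norm y) *\<^sub>R y"
    have nx: "norm x = 1" using y(1) by (simp add: x_def)
    have "(D x \<bullet> x) / (X x \<bullet> x) = (D y \<bullet> y) / (X y \<bullet> y)"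
      using y(1) by (simp add: x_def linear_scale[OF linD] linear_scale[OF linX])
    moreover have Xx: "0 < X x \<bullet> x" using nx by (intro Xpos) auto
    ultimately have "(\<nu> - inverse (real (Suc n))) * (X x \<bullet> x) < D x \<bullet> x"
      using y(2) by (metis pos_less_divide_eq)
    then have "M x \<bullet> x \<le> inverse (real (Suc n)) * (X x \<bullet> x)"
      by (simp add: M_def inner_diff_left left_diff_distrib)
    also have "X x \<bullet> x \<le> KX"
      using norm_cauchy_schwarz[of "X x" x] KX(2)[of x] nx by simp
    finally have "M x \<bullet> x \<le> KX * inverse (real (Suc n))"
      by (simp add: mult.commute)
    with nx show ?thesis by blast
  qed
  then obtain u where u: "\<And>n. norm (u n) = 1" "\<And>n. M (u n) \<bullet> u n \<le> KX * inverse (real (Suc n))"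
    by metis
  have "(\<lambda>n. (norm (M (u n)))\<^sup>2) \<longlonglongrightarrow> 0"
  proof (rule tendsto_sandwich[OF _ _ tendsto_const])
    show "\<forall>\<^sub>F n in sequentially. (norm (M (u n)))\<^sup>2 \<le> K * (KX * inverse (real (Suc n)))"
      using M_le u(2) K(1) by (auto intro!: always_eventually order_trans[OF M_le] mult_left_mono)
    show "(\<lambda>n. K * (KX * inverse (real (Suc n)))) \<longlonglongrightarrow> 0"
      using tendsto_mult_right_zero[OF tendsto_mult_right_zero[OF LIMSEQ_inverse_real_of_nat]] .
  qed simp
  then have M0: "(\<lambda>n. M (u n)) \<longlonglongrightarrow> 0"
    by (simp add: tendsto_norm_zero_iff)
  have "compact (closure (D ` cball 0 1))"
    using D(1) by (auto simp: compact_operator_def)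
  moreover have "D (u n) \<in> closure (D ` cball 0 1)" for n
    by (rule subsetD[OF closure_subset imageI]) (simp add: u(1))
  ultimately obtain z r where r: "strict_mono r" and z: "(\<lambda>n. D (u (r n))) \<longlonglongrightarrow> z"
    unfolding compact_def by (fastforce simp: o_def)
  \<comment> \<open>Since \<open>\<nu> X = M + D\<close>, convergence of \<open>M\<close> and
    \<open>D\<close> along the subsequence gives that of \<open>X\<close>, and \<open>X\<close> is
    bounded below.\<close>
  have "(\<lambda>n. inverse \<nu> *\<^sub>R (M (u (r n)) + D (u (r n)))) \<longlonglongrightarrow> inverse \<nu> *\<^sub>R (0 + z)"
    using LIMSEQ_subseq_LIMSEQ[OF M0 r] by (intro tendsto_intros z) (simp add: o_def)
  then have Xu: "(\<lambda>n. X (u (r n))) \<longlonglongrightarrow> inverse \<nu> *\<^sub>R z"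
    using \<nu> by (simp add: M_def)
  have X_below: "\<epsilon> * norm x \<le> norm (X x)" for x
  proof (cases "x = 0")
    case False
    have "\<epsilon> * norm x * norm x \<le> norm (X x) * norm x"
      using \<epsilon>(2)[of x] norm_cauchy_schwarz[of "X x" x] by (simp add: power2_eq_square)
    then show ?thesis using False by simp
  qed simp
  have "Cauchy (\<lambda>n. u (r n))"
  proof (rule metric_CauchyI)
    fix e :: real assume "0 < e"
    then obtain N where N: "\<And>m n. m \<ge> N \<Longrightarrow> n \<ge> N \<Longrightarrow> dist (X (u (r m))) (X (u (r n))) < \<epsilon> * e"
      using metric_CauchyD[OF LIMSEQ_imp_Cauchy[OF Xu], of "\<epsilon> * e"] \<epsilon>(1) by auto
    have "dist (u (r m)) (u (r n)) < e" if "m \<ge> N" "n \<ge> N" for m n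
    proof -
      have "\<epsilon> * dist (u (r m)) (u (r n)) < \<epsilon> * e"
        using N[OF that] X_below[of "u (r m) - u (r n)"] by (simp add: dist_norm linear_diff[OF linX])
      then show ?thesis using \<epsilon>(1) by simp
    qed
    then show "\<exists>N. \<forall>m\<ge>N. \<forall>n\<ge>N. dist (u (r m)) (u (r n)) < e" by blast
  qed
  then obtain x where x: "(\<lambda>n. u (r n)) \<longlonglongrightarrow> x"
    using Cauchy_convergent convergent_def by blast
  have "norm x = 1"
    using tendsto_norm[OF x] by (simp add: u LIMSEQ_const_iff)
  moreover have "D x = z"
    using bounded_linear.tendsto[OF Dbl x] z by (rule LIMSEQ_unique)
  moreover have "X x = inverse \<nu> *\<^sub>R z"
    using bounded_linear.tendsto[OF X(1) x] Xu by (rule LIMSEQ_unique)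
  ultimately have "x \<noteq> 0" "D x = \<nu> *\<^sub>R X x" using \<nu> by auto
  with \<nu> form show ?thesis by blast
qed

section \<open>Comparison principle and a priori estimates\<close>

locale riccati_problem = coercive_operator i A \<omega>
  for i :: "'v::{real_inner, polish_space} \<Rightarrow> 'h::{real_inner, polish_space}" and A \<omega> +
  fixes F \<Gamma> :: "'h \<Rightarrow> 'h"
  assumes F: "hilbert_schmidt F" "\<And>x y. F x \<bullet> y = x \<bullet> F y" "\<And>x. 0 \<le> F x \<bullet> x"
    and \<Gamma>: "hilbert_schmidt \<Gamma>" "\<And>x y. \<Gamma> x \<bullet> y = x \<bullet> \<Gamma> y" "\<And>x. 0 \<le> \<Gamma> x \<bullet> x"
begin

section \<open>Symmetric operators as compact operators on \<open>H\<close>\<close>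

definition op :: "('h, 'v) hs \<Rightarrow> 'h \<Rightarrow> 'h" where "op P x = i (hs_apply P x)"

lemma op_simps [simp]:
  notes lin = bounded_linear.linear[OF i]
  shows "op 0 x = 0" "op (P + Q) x = op P x + op Q x" "op (P - Q) x = op P x - op Q x"
    "op (- P) x = - op P x" "op (c *\<^sub>R P) x = c *\<^sub>R op P x"
  by (simp_all add: op_def linear_add[OF lin] linear_diff[OF lin] linear_neg[OF lin]
      linear_scale[OF lin] linear_0[OF lin])

lemma bounded_linear_op: "bounded_linear (op P)"
  unfolding op_def by (rule bounded_linear_compose[OF i bounded_linear_hs_apply])

lemma inj_i: "inj i"
  using triple by (simp add: gelfand_triple_def)

lemma compact_op: "compact_operator (op P)"
  unfolding compact_operator_def
proof (intro conjI allI impI bounded_linear_op)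
  fix S :: "'h set" assume "bounded S"
  then have "bounded (hs_apply P ` S)"
    by (rule bounded_linear_image[OF _ bounded_linear_hs_apply])
  then have "compact (closure (i ` hs_apply P ` S))"
    using compact by (auto simp: compact_operator_def)
  then show "compact (closure (op P ` S))"
    by (simp add: image_image op_def)
qed

abbreviation W :: "('h, 'v) hs set" where "W \<equiv> symmetric_hs i"

lemma op_sym: "P \<in> W \<Longrightarrow> op P x \<bullet> y = x \<bullet> op P y"
  by (simp add: op_def symmetric_hsD)

definition nonneg :: "('h, 'v) hs \<Rightarrow> bool" where "nonneg P \<longleftrightarrow> (\<forall>y. 0 \<le> op P y \<bullet> y)"

lemma \<Gamma>_bl: "bounded_linear \<Gamma>" and F_bl: "bounded_linear F"
  using F \<Gamma> by (simp_all add: hilbert_schmidt_bounded_linear)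

definition \<gamma> :: real where "\<gamma> = onorm \<Gamma> * (onorm i)\<^sup>2"

text \<open>Chosen so that \<open>\<epsilon> * \<gamma> \<le> \<omega>\<close>: the coercivity of
  \<open>A\<close> then absorbs the term \<open>\<epsilon>\<^sup>2 * g\<close> in
  \<open>comparison\<close>. The \<open>+ 1\<close> avoids division by zero.\<close>

definition \<epsilon> :: real where "\<epsilon> = \<omega> / (\<gamma> + 1)"

lemma quadratic_form_le:
  assumes T: "bounded_linear T"
  shows "T (i v) \<bullet> i v \<le> onorm T * (onorm i)\<^sup>2 * (norm v)\<^sup>2"
proof -
  have "T (i v) \<bullet> i v \<le> norm (T (i v)) * norm (i v)" by (rule norm_cauchy_schwarz)
  also have "\<dots> \<le> onorm T * norm (i v) * norm (i v)" by (intro mult_right_mono onorm T) simp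
  also have "\<dots> = onorm T * (norm (i v))\<^sup>2" by (simp add: power2_eq_square)
  also have "\<dots> \<le> onorm T * (onorm i * norm v)\<^sup>2"
    by (intro mult_left_mono power_mono onorm i onorm_pos_le T) simp
  finally show ?thesis by (simp add: power_mult_distrib mult_ac)
qed

lemma \<Gamma>_le: "\<Gamma> (i v) \<bullet> i v \<le> \<gamma> * (norm v)\<^sup>2"
  unfolding \<gamma>_def by (rule quadratic_form_le[OF \<Gamma>_bl])

lemma \<gamma>: "0 \<le> \<gamma>"
  unfolding \<gamma>_def by (intro mult_nonneg_nonneg onorm_pos_le \<Gamma>_bl) simp

lemma \<epsilon>: "0 < \<epsilon>" "\<epsilon> * \<gamma> \<le> \<omega>"
proof -
  show "0 < \<epsilon>" using \<omega> \<gamma> by (simp add: \<epsilon>_def)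
  have "\<omega> * \<gamma> \<le> \<omega> * (\<gamma> + 1)" using \<omega> by simp
  then show "\<epsilon> * \<gamma> \<le> \<omega>" using \<gamma> by (simp add: \<epsilon>_def pos_divide_le_eq)
qed

text \<open>The heart of the argument: if \<open>P \<ge> 0\<close> is a subsolution in the sense of the third assumption,
  then \<open>A + t \<Gamma> P\<close> is coercive with respect to the inner product given by \<open>\<epsilon> + P\<close>. This is
  evaluated at an extremal point of \<open>D\<close> relative to \<open>\<epsilon> + P\<close>, which lies in \<open>V\<close>.\<close>

lemma comparison:
  assumes t: "0 \<le> t" "t \<le> 1" and P: "P \<in> W" "nonneg P"
    and sub: "\<And>v. 0 \<le> 2 * pairing (A v) (hs_apply P (i v)) + t * (\<Gamma> (op P (i v)) \<bullet> op P (i v))"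
    and D: "D \<in> W" and pos: "0 < op D y0 \<bullet> y0"
  shows "\<exists>\<nu>>0. \<exists>v. v \<noteq> 0 \<and> op D (i v) = \<nu> *\<^sub>R (\<epsilon> *\<^sub>R i v + op P (i v)) \<and>
    (\<forall>y. op D y \<bullet> y \<le> \<nu> * (\<epsilon> * (norm y)\<^sup>2 + op P y \<bullet> y)) \<and>
    \<nu> * \<epsilon> * \<omega> * (norm v)\<^sup>2
      \<le> 2 * pairing (A v) (hs_apply D (i v)) + 2 * t * (\<Gamma> (op P (i v)) \<bullet> op D (i v))"
proof -
  define X where "X x = \<epsilon> *\<^sub>R x + op P x" for x
  have X: "bounded_linear X" "\<And>x y. X x \<bullet> y = x \<bullet> X y"
    unfolding X_def using P
    by (auto intro!: bounded_linear_add bounded_linear_scaleR_right bounded_linear_op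
        simp: inner_simps op_sym)
  have X_ge: "\<epsilon> * (norm x)\<^sup>2 \<le> X x \<bullet> x" for x
    using P(2) by (simp add: X_def nonneg_def inner_add_left power2_norm_eq_inner)
  obtain \<nu> z where \<nu>: "0 < \<nu>" and z: "z \<noteq> 0" "op D z = \<nu> *\<^sub>R X z"
    and D_le: "\<And>y. op D y \<bullet> y \<le> \<nu> * (X y \<bullet> y)"
    using generalized_eigenvector[OF compact_op op_sym[OF D] X \<epsilon>(1) X_ge pos] by blast
  \<comment> \<open>The relation \<open>op D z = \<nu> *\<^sub>R X z\<close> solved for
    \<open>z\<close>; as \<open>D\<close> and \<open>P\<close> map into \<open>V\<close>, this
    exhibits a preimage of \<open>z\<close> under \<open>i\<close>.\<close>
  define v where "v = (1 / \<epsilon>) *\<^sub>R ((1 / \<nu>) *\<^sub>R hs_apply D z - hs_apply P z)"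
  note lin = bounded_linear.linear[OF i]
  have "i v = (1 / \<epsilon>) *\<^sub>R ((1 / \<nu>) *\<^sub>R op D z - op P z)"
    by (simp add: v_def op_def linear_diff[OF lin] linear_scale[OF lin])
  also have "\<dots> = z" using \<nu> \<epsilon>(1) by (simp add: z(2) X_def)
  finally have iv: "i v = z" .
  then have v: "v \<noteq> 0" using z(1) linear_0[OF lin] by auto
  have Dz: "hs_apply D z = \<nu> *\<^sub>R (\<epsilon> *\<^sub>R v + hs_apply P z)"
    using \<nu> \<epsilon>(1) by (simp add: v_def)
  define a where "a = pairing (A v) v"
  define p where "p = pairing (A v) (hs_apply P z)"
  define q where "q = \<Gamma> (op P z) \<bullet> op P z"
  define m where "m = \<Gamma> (op P z) \<bullet> z"
  define g where "g = \<Gamma> z \<bullet> z"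
  have eq: "2 * pairing (A v) (hs_apply D z) + 2 * t * (\<Gamma> (op P z) \<bullet> op D z)
      = \<nu> * (2 * \<epsilon> * a + 2 * p + 2 * t * (\<epsilon> * m + q))"
    by (simp add: Dz z(2) X_def a_def p_def q_def m_def inner_simps algebra_simps)
  have a: "\<omega> * (norm v)\<^sup>2 \<le> a" unfolding a_def by (rule coercive)
  have g: "g \<le> \<gamma> * (norm v)\<^sup>2" "0 \<le> g" unfolding g_def using \<Gamma>_le[of v] \<Gamma>(3) by (auto simp: iv)
  have pq: "0 \<le> 2 * p + t * q" unfolding p_def q_def using sub[of v] by (simp add: iv)
  \<comment> \<open>The mixed term \<open>m\<close> has no sign. Nonnegativity of
    \<open>\<Gamma>\<close> at this vector trades \<open>2 * \<epsilon> * m\<close> for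
    \<open>- q - \<epsilon>\<^sup>2 * g\<close>; the loss of \<open>q\<close> leaves exactly
    \<open>2 * p + t * q\<close>, which is nonnegative by \<open>sub\<close>.\<close>
  have "0 \<le> \<Gamma> (\<epsilon> *\<^sub>R z + op P z) \<bullet> (\<epsilon> *\<^sub>R z + op P z)" by (rule \<Gamma>(3))
  also have "\<dots> = \<epsilon>\<^sup>2 * g + 2 * \<epsilon> * m + q"
    using \<Gamma>(2)[of z "op P z"] bounded_linear.linear[OF \<Gamma>_bl]
    by (simp add: linear_add linear_scale inner_simps g_def m_def q_def power2_eq_square
        inner_commute algebra_simps)
  finally have "0 \<le> t * (\<epsilon>\<^sup>2 * g + 2 * \<epsilon> * m + q)" using t by simp
  moreover have "t * (\<epsilon>\<^sup>2 * g) \<le> \<epsilon> * \<omega> * (norm v)\<^sup>2"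
  proof -
    have "t * (\<epsilon>\<^sup>2 * g) \<le> 1 * (\<epsilon>\<^sup>2 * (\<gamma> * (norm v)\<^sup>2))"
      using t g by (intro mult_mono mult_left_mono) auto
    also have "\<dots> = \<epsilon> * (\<epsilon> * \<gamma>) * (norm v)\<^sup>2" by (simp add: power2_eq_square)
    also have "\<dots> \<le> \<epsilon> * \<omega> * (norm v)\<^sup>2"
      using \<epsilon> by (intro mult_right_mono mult_left_mono) auto
    finally show ?thesis .
  qed
  moreover have "\<epsilon> * (\<omega> * (norm v)\<^sup>2) \<le> \<epsilon> * a"
    using a \<epsilon>(1) by (intro mult_left_mono) auto
  ultimately have "\<epsilon> * \<omega> * (norm v)\<^sup>2 \<le> 2 * \<epsilon> * a + 2 * p + 2 * t * (\<epsilon> * m + q)"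
    using pq by (simp add: algebra_simps)
  then have "\<nu> * (\<epsilon> * \<omega> * (norm v)\<^sup>2) \<le> \<nu> * (2 * \<epsilon> * a + 2 * p + 2 * t * (\<epsilon> * m + q))"
    using \<nu> by simp
  then have "\<nu> * \<epsilon> * \<omega> * (norm v)\<^sup>2
      \<le> 2 * pairing (A v) (hs_apply D (i v)) + 2 * t * (\<Gamma> (op P (i v)) \<bullet> op D (i v))"
    unfolding iv eq by (simp add: mult.assoc)
  moreover have "op D (i v) = \<nu> *\<^sub>R (\<epsilon> *\<^sub>R i v + op P (i v))"
    by (simp add: iv z(2) X_def)
  moreover have "\<forall>y. op D y \<bullet> y \<le> \<nu> * (\<epsilon> * (norm y)\<^sup>2 + op P y \<bullet> y)"
    using D_le by (simp add: X_def inner_add_left power2_norm_eq_inner)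
  ultimately show ?thesis using \<nu> v by blast
qed

section \<open>Solutions of the equation with \<open>t \<Gamma>\<close>, and uniqueness\<close>

definition solves :: "real \<Rightarrow> ('h, 'v) hs \<Rightarrow> bool" where
  "solves t P \<longleftrightarrow> P \<in> W \<and>
    (\<forall>x y. lyapunov_form i A P x y + t * (\<Gamma> (op P (i x)) \<bullet> op P (i y)) = F (i x) \<bullet> i y)"

lemma solves_diag:
  assumes "solves t P"
  shows "2 * pairing (A v) (hs_apply P (i v)) + t * (\<Gamma> (op P (i v)) \<bullet> op P (i v)) = F (i v) \<bullet> i v"
proof -
  have "lyapunov_form i A P v v + t * (\<Gamma> (op P (i v)) \<bullet> op P (i v)) = F (i v) \<bullet> i v"
    using assms unfolding solves_def by blast
  then show ?thesis by (simp add: lyapunov_form_def)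
qed

lemma solves_W: "solves t P \<Longrightarrow> P \<in> W"
  by (simp add: solves_def)

text \<open>Because \<open>F \<ge> 0\<close>, the diagonal of the equation is the subsolution
  condition of \<open>comparison\<close>.\<close>

lemma comparison_solution:
  assumes t: "0 \<le> t" "t \<le> 1" and P: "solves t P" "nonneg P"
    and D: "D \<in> W" and pos: "0 < op D y0 \<bullet> y0"
  obtains \<nu> v where "0 < \<nu>" "v \<noteq> 0" "\<And>y. op D y \<bullet> y \<le> \<nu> * (\<epsilon> * (norm y)\<^sup>2 + op P y \<bullet> y)"
    "\<nu> * \<epsilon> * \<omega> * (norm v)\<^sup>2
      \<le> 2 * pairing (A v) (hs_apply D (i v)) + 2 * t * (\<Gamma> (op P (i v)) \<bullet> op D (i v))"
proof -
  have "0 \<le> 2 * pairing (A v) (hs_apply P (i v)) + t * (\<Gamma> (op P (i v)) \<bullet> op P (i v))" for v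
    using solves_diag[OF P(1)] F(3) by simp
  from comparison[OF t solves_W[OF P(1)] P(2) this D pos] that show thesis by blast
qed

text \<open>With \<open>P = 0\<close> the weight is a multiple of the identity, so the extremal
  vector is an eigenvector of \<open>D\<close> for its largest eigenvalue
  \<open>s = \<nu> * \<epsilon>\<close>.\<close>

lemma comparison_zero:
  assumes D: "D \<in> W" and pos: "0 < op D y0 \<bullet> y0"
  obtains s v where "0 < s" "v \<noteq> 0" "op D (i v) = s *\<^sub>R i v" "\<And>y. op D y \<bullet> y \<le> s * (norm y)\<^sup>2"
    "s * \<omega> * (norm v)\<^sup>2 \<le> 2 * pairing (A v) (hs_apply D (i v))"
proof -
  have "0 \<in> W" by (rule subspace_0[OF subspace_symmetric_hs[OF i]])
  moreover have "nonneg 0" by (simp add: nonneg_def)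
  ultimately obtain \<nu> v where "0 < \<nu>" "v \<noteq> 0" "op D (i v) = (\<nu> * \<epsilon>) *\<^sub>R i v"
    "\<And>y. op D y \<bullet> y \<le> \<nu> * \<epsilon> * (norm y)\<^sup>2"
    "\<nu> * \<epsilon> * \<omega> * (norm v)\<^sup>2 \<le> 2 * pairing (A v) (hs_apply D (i v))"
    using comparison[of 0 0 D y0] D pos by (auto simp: mult.assoc)
  then show thesis using that[of "\<nu> * \<epsilon>" v] \<epsilon>(1) by (simp add: mult.assoc)
qed

text \<open>A nonnegative solution dominates every other one; two nonnegative solutions dominate
  each other, and a symmetric operator with vanishing form is zero.\<close>

lemma solution_unique:
  assumes P: "solves 1 P" "nonneg P" and Q: "solves 1 Q" "nonneg Q"
  shows "P = Q"
proof -
  have le: "op P y \<bullet> y \<le> op Q y \<bullet> y" if P: "solves 1 P" and Q: "solves 1 Q" "nonneg Q" for P Q y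
  proof (rule ccontr)
    assume "\<not> op P y \<bullet> y \<le> op Q y \<bullet> y"
    then have "0 < op (P - Q) y \<bullet> y" by (simp add: inner_diff_left)
    moreover have "P - Q \<in> W"
      by (intro subspace_diff[OF subspace_symmetric_hs[OF i]] solves_W[OF P] solves_W[OF Q(1)])
    ultimately obtain \<nu> v where \<nu>: "0 < \<nu>" and v: "v \<noteq> 0"
      and le: "\<nu> * \<epsilon> * \<omega> * (norm v)\<^sup>2 \<le> 2 * pairing (A v) (hs_apply (P - Q) (i v))
        + 2 * 1 * (\<Gamma> (op Q (i v)) \<bullet> op (P - Q) (i v))"
      using comparison_solution[OF zero_le_one order_refl Q] by metis
    \<comment> \<open>Subtracting the two equations on the diagonal, the right-hand side of
      \<open>le\<close> becomes \<open>- (\<Gamma> ?D \<bullet> ?D)\<close>.\<close>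
    let ?D = "op P (i v) - op Q (i v)"
    have "0 \<le> \<Gamma> ?D \<bullet> ?D" by (rule \<Gamma>(3))
    moreover have "\<Gamma> (op P (i v)) \<bullet> op Q (i v) = \<Gamma> (op Q (i v)) \<bullet> op P (i v)"
      using \<Gamma>(2)[of "op P (i v)" "op Q (i v)"] by (simp add: inner_commute)
    ultimately have "\<nu> * \<epsilon> * \<omega> * (norm v)\<^sup>2 \<le> 0"
      using le solves_diag[OF P, of v] solves_diag[OF Q(1), of v]
      by (simp add: linear_diff[OF bounded_linear.linear[OF \<Gamma>_bl]] inner_diff_left inner_diff_right)
    moreover have "0 < \<nu> * \<epsilon> * \<omega> * (norm v)\<^sup>2"
      using \<nu> \<epsilon>(1) \<omega> v by simp
    ultimately show False by simp
  qed
  have W: "P - Q \<in> W"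
    by (intro subspace_diff[OF subspace_symmetric_hs[OF i]] solves_W[OF P(1)] solves_W[OF Q(1)])
  have "norm (op (P - Q) y) \<le> 0 * norm y" for y
    using le[OF P(1) Q] le[OF Q(1) P]
    by (intro norm_le_of_form_bound bounded_linear.linear[OF bounded_linear_op] op_sym[OF W])
      (simp add: inner_diff_left order_antisym)
  then have "i (hs_apply (P - Q) y) = i 0" for y
    by (simp add: op_def linear_0[OF bounded_linear.linear[OF i]] del: hs_apply_simps)
  then have "hs_apply (P - Q) y = 0" for y
    by (rule injD[OF inj_i])
  then show ?thesis by (intro hs_eqI) simp
qed

section \<open>Bounds uniform in \<open>t\<close>\<close>

definition \<mu> :: real where "\<mu> = onorm F * (onorm i)\<^sup>2 / \<omega>"

lemma solution_bound:
  assumes t: "0 \<le> t" and P: "solves t P" "nonneg P"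
  shows "op P y \<bullet> y \<le> \<mu> * (norm y)\<^sup>2" and "norm (op P y) \<le> \<mu> * norm y"
proof -
  show form: "op P y \<bullet> y \<le> \<mu> * (norm y)\<^sup>2" for y
  proof (cases "0 < op P y \<bullet> y")
    case True
    then obtain s v where s: "0 < s" "v \<noteq> 0" and le: "\<And>y. op P y \<bullet> y \<le> s * (norm y)\<^sup>2"
      and v: "s * \<omega> * (norm v)\<^sup>2 \<le> 2 * pairing (A v) (hs_apply P (i v))"
      using comparison_zero[OF solves_W[OF P(1)]] by metis
    have "0 \<le> t * (\<Gamma> (op P (i v)) \<bullet> op P (i v))" using t \<Gamma>(3) by simp
    then have "s * \<omega> * (norm v)\<^sup>2 \<le> onorm F * (onorm i)\<^sup>2 * (norm v)\<^sup>2"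
      using v solves_diag[OF P(1), of v] quadratic_form_le[OF F_bl, of v] by linarith
    then have "s \<le> \<mu>"
      using s(2) \<omega> by (simp add: \<mu>_def pos_le_divide_eq)
    then show ?thesis using le[of y] mult_right_mono[of s \<mu> "(norm y)\<^sup>2"] by simp
  next
    case False
    have "0 \<le> \<mu>" using \<omega> onorm_pos_le[OF F_bl] by (simp add: \<mu>_def)
    then have "0 \<le> \<mu> * (norm y)\<^sup>2" by simp
    then show ?thesis using False by linarith
  qed
  show "norm (op P y) \<le> \<mu> * norm y"
    using form P(2) by (intro norm_le_of_form_bound bounded_linear.linear[OF bounded_linear_op]
        op_sym[OF solves_W[OF P(1)]]) (simp add: nonneg_def)
qed

text \<open>At the lowest eigenvalue \<open>- s\<close> the coercive part is at least
  \<open>s * \<omega>\<close> and the quadratic term at most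
  \<open>t * s\<^sup>2 * \<gamma>\<close>, relative to \<open>(norm v)\<^sup>2\<close>. This gap
  below zero separates nonnegative solutions from the others.\<close>

lemma not_nonneg_solution:
  assumes t: "0 \<le> t" "t \<le> 1" and P: "solves t P" "\<not> nonneg P"
  obtains s z where "0 < s" "z \<noteq> 0" "op P z = - s *\<^sub>R z" "\<omega> \<le> t * s * \<gamma>"
proof -
  obtain y where y: "0 < op (- P) y \<bullet> y"
    using P(2) by (auto simp: nonneg_def not_le)
  have "- P \<in> W"
    by (rule subspace_neg[OF subspace_symmetric_hs[OF i] solves_W[OF P(1)]])
  with y obtain s v where s: "0 < s" "v \<noteq> 0" and eig: "op (- P) (i v) = s *\<^sub>R i v"
    and le: "s * \<omega> * (norm v)\<^sup>2 \<le> 2 * pairing (A v) (hs_apply (- P) (i v))"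
    using comparison_zero[of "- P" y] by metis
  have Pv: "op P (i v) = - s *\<^sub>R i v"
    using arg_cong[OF eig, of uminus] by simp
  have "s * \<omega> * (norm v)\<^sup>2 \<le> t * (\<Gamma> (op P (i v)) \<bullet> op P (i v))"
    using le solves_diag[OF P(1), of v] F(3)[of "i v"] by simp
  also have "\<dots> = s * (t * s * (\<Gamma> (i v) \<bullet> i v))"
    using bounded_linear.linear[OF \<Gamma>_bl] by (simp add: Pv linear_scale linear_neg)
  also have "\<dots> \<le> s * (t * s * (\<gamma> * (norm v)\<^sup>2))"
    using s t by (intro mult_left_mono \<Gamma>_le) auto
  finally have "s * (norm v)\<^sup>2 * \<omega> \<le> s * (norm v)\<^sup>2 * (t * s * \<gamma>)"
    by (simp add: mult_ac)
  then have "\<omega> \<le> t * s * \<gamma>" using s by simp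
  moreover have "i v \<noteq> 0"
    using s(2) injD[OF inj_i, of v 0] linear_0[OF bounded_linear.linear[OF i]] by auto
  ultimately show thesis using that[of s "i v"] s(1) Pv by simp
qed

section \<open>Existence\<close>

lemma norm_op_le: "norm (op P x) \<le> onorm i * norm P * norm x"
proof -
  have "norm (op P x) \<le> onorm i * norm (hs_apply P x)"
    unfolding op_def by (rule onorm[OF i])
  also have "\<dots> \<le> onorm i * (norm P * norm x)"
    by (intro mult_left_mono norm_hs_apply_le onorm_pos_le i)
  finally show ?thesis by (simp add: mult.assoc)
qed

section \<open>The quadratic term as a bilinear map\<close>

definition quad :: "('h, 'v) hs \<Rightarrow> ('h, 'v) hs \<Rightarrow> ('h, 'h) hs" where
  "quad P Q = hs_comp (\<lambda>v. op P (\<Gamma> (i v))) Q"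

lemma quad_apply [simp]: "hs_apply (quad P Q) x = op P (\<Gamma> (op Q x))"
proof -
  have "bounded_linear (\<lambda>v. op P (\<Gamma> (i v)))"
    by (intro bounded_linear_compose[OF bounded_linear_op] bounded_linear_compose[OF \<Gamma>_bl] i)
  then show ?thesis by (simp add: quad_def op_def)
qed

lemma norm_quad_commute: "P \<in> W \<Longrightarrow> Q \<in> W \<Longrightarrow> norm (quad P Q) = norm (quad Q P)"
  by (rule norm_hs_adjoint) (simp add: op_sym \<Gamma>)

lemma norm_quad_le: "norm (quad P Q) \<le> norm P * norm Q * (onorm i * onorm \<Gamma> * onorm i)"
proof -
  let ?C = "onorm i * norm P * (onorm \<Gamma> * onorm i)"
  have "norm (hs_apply (quad P Q) x) \<le> ?C * norm (hs_apply Q x)" for x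
  proof -
    have "norm (hs_apply (quad P Q) x) \<le> onorm i * norm P * norm (\<Gamma> (op Q x))"
      by (simp add: norm_op_le)
    also have "\<dots> \<le> onorm i * norm P * (onorm \<Gamma> * (onorm i * norm (hs_apply Q x)))"
      unfolding op_def
      by (intro mult_left_mono order_trans[OF onorm[OF \<Gamma>_bl]] onorm i mult_nonneg_nonneg
          onorm_pos_le \<Gamma>_bl) simp
    finally show ?thesis by (simp add: mult.assoc)
  qed
  then have "norm (quad P Q) \<le> ?C * norm Q"
    by (intro norm_hs_le mult_nonneg_nonneg onorm_pos_le i \<Gamma>_bl) auto
  then show ?thesis by (simp add: mult_ac)
qed

text \<open>The Hilbert--Schmidt norm is taken from \<open>\<Gamma>\<close>, so that \<open>P\<close> and \<open>D\<close> enter with their operator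
  norms only.\<close>

lemma norm_quad_le_op:
  assumes P: "P \<in> W" "0 \<le> m" "\<And>y. norm (op P y) \<le> m * norm y"
    and D: "0 \<le> \<kappa>" "\<And>y. norm (op D y) \<le> \<kappa> * norm y"
  shows "norm (quad D P) \<le> \<kappa> * (m * norm (Hs \<Gamma>))"
proof -
  let ?R = "hs_comp (\<lambda>v. \<Gamma> (i v)) P"
  let ?L = "hs_comp (op P) (Hs \<Gamma>)"
  have bl: "bounded_linear (\<lambda>v. \<Gamma> (i v))"
    by (intro bounded_linear_compose[OF \<Gamma>_bl] i)
  \<comment> \<open>\<open>\<Gamma> P\<close> and \<open>P \<Gamma>\<close> are adjoint in
    \<open>H\<close>; in the second order \<open>P\<close> stands on the left and is measured by
    \<open>m\<close>.\<close>
  have "norm ?R = norm ?L"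
    by (rule norm_hs_adjoint)
      (simp add: bl bounded_linear_op \<Gamma>(1) \<Gamma>(2) op_sym[OF P(1)] flip: op_def)
  also have "\<dots> \<le> m * norm (Hs \<Gamma>)"
    by (rule norm_hs_le) (simp_all add: P bounded_linear_op \<Gamma>(1))
  finally have "\<kappa> * norm ?R \<le> \<kappa> * (m * norm (Hs \<Gamma>))"
    using D(1) by (rule mult_left_mono)
  moreover have "norm (quad D P) \<le> \<kappa> * norm ?R"
    by (rule norm_hs_le) (simp_all add: D bl flip: op_def)
  ultimately show ?thesis by simp
qed

lemma \<mu>: "0 \<le> \<mu>"
  using \<omega> onorm_pos_le[OF F_bl] by (simp add: \<mu>_def)

text \<open>The factor \<open>\<epsilon> + \<mu>\<close> bounds the form of
  \<open>\<epsilon> + P\<close>; the rest, times \<open>norm g\<close>, bounds the extremal ratio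
  \<open>\<nu>\<close>.\<close>

definition \<kappa> :: real where "\<kappa> = 2 * onorm A * onorm i * (\<epsilon> + \<mu>) / (\<epsilon> * \<omega>)"

lemma \<kappa>: "0 \<le> \<kappa>"
  unfolding \<kappa>_def using \<epsilon>(1) \<omega> \<mu>
  by (intro divide_nonneg_nonneg mult_nonneg_nonneg onorm_pos_le A i) auto

text \<open>\<open>eq\<close> is the diagonal of the linearised equation with right-hand side
  \<open>A\<^sup>* g + g A\<close>. The estimate is one-sided, to be applied to \<open>D\<close> and
  \<open>- D\<close>.\<close>

lemma linearised_form_bound:
  assumes t: "0 \<le> t" "t \<le> 1" and P: "solves t P" "nonneg P" and D: "D \<in> W"
    and eq: "\<And>v. 2 * pairing (A v) (hs_apply D (i v)) + 2 * t * (\<Gamma> (op P (i v)) \<bullet> op D (i v))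
      = 2 * pairing (A v) (hs_apply g (i v))"
  shows "op D y \<bullet> y \<le> \<kappa> * norm g * (norm y)\<^sup>2"
proof (cases "0 < op D y \<bullet> y")
  case True
  then obtain \<nu> v where \<nu>: "0 < \<nu>" and v: "v \<noteq> 0"
    and D_le: "\<And>y. op D y \<bullet> y \<le> \<nu> * (\<epsilon> * (norm y)\<^sup>2 + op P y \<bullet> y)"
    and le: "\<nu> * \<epsilon> * \<omega> * (norm v)\<^sup>2
      \<le> 2 * pairing (A v) (hs_apply D (i v)) + 2 * t * (\<Gamma> (op P (i v)) \<bullet> op D (i v))"
    using comparison_solution[OF t P D] by metis
  have "pairing (A v) (hs_apply g (i v)) \<le> norm (A v) * norm (hs_apply g (i v))"
    using onorm[OF bounded_linear_pairing, of "A v" "hs_apply g (i v)"] by (simp add: norm_topdual)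
  also have "\<dots> \<le> (onorm A * norm v) * (norm g * (onorm i * norm v))"
    by (intro mult_mono onorm A order_trans[OF norm_hs_apply_le] mult_left_mono i
        mult_nonneg_nonneg onorm_pos_le) auto
  finally have "\<nu> * (\<epsilon> * \<omega>) * (norm v)\<^sup>2 \<le> 2 * onorm A * onorm i * norm g * (norm v)\<^sup>2"
    using le eq[of v] by (simp add: power2_eq_square mult_ac)
  then have "\<nu> * (\<epsilon> * \<omega>) \<le> 2 * onorm A * onorm i * norm g"
    using v by simp
  then have \<nu>_le: "\<nu> \<le> 2 * onorm A * onorm i * norm g / (\<epsilon> * \<omega>)"
    using \<epsilon>(1) \<omega> by (simp add: pos_le_divide_eq)
  have "op D y \<bullet> y \<le> \<nu> * (\<epsilon> * (norm y)\<^sup>2 + \<mu> * (norm y)\<^sup>2)"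
    using D_le[of y] solution_bound(1)[OF t(1) P, of y] \<nu>
    by (smt (verit) mult_left_mono)
  also have "\<dots> = \<nu> * ((\<epsilon> + \<mu>) * (norm y)\<^sup>2)"
    by (simp add: algebra_simps)
  also have "\<dots> \<le> 2 * onorm A * onorm i * norm g / (\<epsilon> * \<omega>) * ((\<epsilon> + \<mu>) * (norm y)\<^sup>2)"
    using \<nu>_le \<epsilon>(1) \<mu> by (intro mult_right_mono) auto
  also have "\<dots> = \<kappa> * norm g * (norm y)\<^sup>2"
    by (simp add: \<kappa>_def mult_ac)
  finally show ?thesis .
next
  case False
  have "0 \<le> \<kappa> * norm g * (norm y)\<^sup>2" using \<kappa> by simp
  then show ?thesis using False by linarith
qed

lemma ex_solution: "\<exists>P. solves 1 P \<and> nonneg P"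
proof -
  obtain T :: "('h, 'h) hs \<Rightarrow> ('h, 'v) hs" where T: "bounded_linear T" and TW: "\<And>G. T G \<in> W"
    and lyap: "\<And>G x y. lyapunov_form i A (T G) x y
      = 1/2 * (hs_apply G (i x) \<bullet> i y + hs_apply G (i y) \<bullet> i x)"
    using ex_lyapunov_operator by blast
  interpret T: bounded_linear T by fact
  define K where "K = onorm T"
  have K: "0 \<le> K" "\<And>G. norm (T G) \<le> K * norm G"
    unfolding K_def by (rule onorm_pos_le[OF T], rule onorm[OF T])
  define f where "f = T (Hs F)"
  \<comment> \<open>Inverting the Lyapunov part turns the equation with \<open>t \<Gamma>\<close>
    into \<open>P + t *\<^sub>R \<beta> P P = f\<close>.\<close>
  define \<beta> where "\<beta> P Q = T (quad P Q)" for P Q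
  note W_sub = subspace_symmetric_hs[OF i]
  have \<beta>: "bounded_bilinear \<beta>"
  proof
    note lin = bounded_linear.linear[OF bounded_linear_op] bounded_linear.linear[OF \<Gamma>_bl]
    show "\<beta> (P + P') Q = \<beta> P Q + \<beta> P' Q" for P P' Q
      unfolding \<beta>_def T.add[symmetric] by (intro arg_cong[where f = T] hs_eqI) simp
    show "\<beta> P (Q + Q') = \<beta> P Q + \<beta> P Q'" for P Q Q'
      unfolding \<beta>_def T.add[symmetric]
      by (intro arg_cong[where f = T] hs_eqI) (simp add: linear_add[OF lin(1)] linear_add[OF lin(2)])
    show "\<beta> (r *\<^sub>R P) Q = r *\<^sub>R \<beta> P Q" for r P Q
      unfolding \<beta>_def T.scaleR[symmetric] by (intro arg_cong[where f = T] hs_eqI) simp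
    show "\<beta> P (r *\<^sub>R Q) = r *\<^sub>R \<beta> P Q" for r P Q
      unfolding \<beta>_def T.scaleR[symmetric]
      by (intro arg_cong[where f = T] hs_eqI) (simp add: linear_scale[OF lin(1)] linear_scale[OF lin(2)])
    have "norm (\<beta> P Q) \<le> norm P * norm Q * (K * (onorm i * onorm \<Gamma> * onorm i))" for P Q
    proof -
      have "norm (\<beta> P Q) \<le> K * norm (quad P Q)"
        unfolding \<beta>_def by (rule K(2))
      also have "\<dots> \<le> K * (norm P * norm Q * (onorm i * onorm \<Gamma> * onorm i))"
        by (intro mult_left_mono norm_quad_le K(1))
      finally show ?thesis by (simp add: mult_ac)
    qed
    then show "\<exists>B. \<forall>P Q. norm (\<beta> P Q) \<le> norm P * norm Q * B" by blast
  qed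
  have solves: "solves t P" if "P \<in> W" "P + t *\<^sub>R \<beta> P P = f" for t P
    unfolding solves_def
  proof (intro conjI allI that(1))
    fix x y
    have "lyapunov_form i A P x y + t * lyapunov_form i A (\<beta> P P) x y = lyapunov_form i A f x y"
      using that(2) by (metis lyapunov_form_simps(2,5))
    moreover have "lyapunov_form i A (\<beta> P P) x y = \<Gamma> (op P (i x)) \<bullet> op P (i y)"
      using \<Gamma>(2)[of "op P (i x)" "op P (i y)"]
      by (simp add: \<beta>_def lyap op_sym[OF that(1)] inner_commute)
    moreover have "lyapunov_form i A f x y = F (i x) \<bullet> i y"
      using F(2)[of "i x" "i y"] by (simp add: f_def lyap F(1) inner_commute)
    ultimately show "lyapunov_form i A P x y + t * (\<Gamma> (op P (i x)) \<bullet> op P (i y)) = F (i x) \<bullet> i y"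
      by simp
  qed
  define \<gamma>' where "\<gamma>' = onorm i * \<gamma>"
  have \<gamma>': "0 \<le> \<gamma>'" unfolding \<gamma>'_def by (intro mult_nonneg_nonneg onorm_pos_le i \<gamma>)
  have "\<exists>P\<in>W. nonneg P \<and> P + \<beta> P P = f"
  proof (rule quadratic_continuation[OF closed_symmetric_hs[OF i] W_sub \<beta>])
    show "\<beta> P Q \<in> W" for P Q unfolding \<beta>_def by (rule TW)
    show fW: "f \<in> W" unfolding f_def by (rule TW)
    \<comment> \<open>\<open>f\<close> solves the equation for \<open>t = 0\<close>, where the gap
      would read \<open>\<omega> \<le> 0\<close>.\<close>
    show "nonneg f"
    proof (rule ccontr)
      assume "\<not> nonneg f"
      then show False
        using not_nonneg_solution[of 0 f] solves[OF fW, of 0] \<omega> by auto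
    qed
  next
    fix t P assume t: "0 \<le> t" "t \<le> 1" and P: "P \<in> W" "nonneg P" and eq: "P + t *\<^sub>R \<beta> P P = f"
    have sol: "solves t P" using P(1) eq by (rule solves)
    have op_P: "norm (op P y) \<le> \<mu> * norm y" for y
      by (rule solution_bound(2)[OF t(1) sol P(2)])
    \<comment> \<open>The equation upgrades the operator norm bound \<open>\<mu>\<close> to a bound
      in the Hilbert--Schmidt norm.\<close>
    have "norm P = norm (f - t *\<^sub>R \<beta> P P)" using eq by (metis add_diff_cancel_right')
    also have "\<dots> \<le> norm f + t * norm (\<beta> P P)"
      using t(1) norm_triangle_ineq4[of f "t *\<^sub>R \<beta> P P"] by simp
    also have "\<dots> \<le> norm f + 1 * (K * (\<mu> * (\<mu> * norm (Hs \<Gamma>))))"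
      unfolding \<beta>_def using t P(1) \<mu> op_P
      by (intro add_left_mono mult_mono order_trans[OF K(2)] mult_left_mono[OF _ K(1)]
          norm_quad_le_op) auto
    finally show "norm P \<le> norm f + 1 * (K * (\<mu> * (\<mu> * norm (Hs \<Gamma>))))" .
    fix D assume D: "D \<in> W"
    define g where "g = D + t *\<^sub>R (\<beta> P D + \<beta> D P)"
    have lin_eq: "2 * pairing (A v) (hs_apply D (i v)) + 2 * t * (\<Gamma> (op P (i v)) \<bullet> op D (i v))
        = 2 * pairing (A v) (hs_apply g (i v))" for v
    proof -
      have "2 * pairing (A v) (hs_apply g (i v)) = lyapunov_form i A g v v"
        by (simp add: lyapunov_form_def)
      also have "\<dots> = 2 * pairing (A v) (hs_apply D (i v))
          + t * (op P (\<Gamma> (op D (i v))) \<bullet> i v + op D (\<Gamma> (op P (i v))) \<bullet> i v)"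
        unfolding g_def lyapunov_form_simps \<beta>_def lyap by (simp add: lyapunov_form_def)
      also have "op P (\<Gamma> (op D (i v))) \<bullet> i v = \<Gamma> (op P (i v)) \<bullet> op D (i v)"
        using \<Gamma>(2)[of "op D (i v)" "op P (i v)"] by (simp add: op_sym[OF P(1)] inner_commute)
      also have "op D (\<Gamma> (op P (i v))) \<bullet> i v = \<Gamma> (op P (i v)) \<bullet> op D (i v)"
        by (simp add: op_sym[OF D])
      finally show ?thesis by simp
    qed
    have "op D y \<bullet> y \<le> \<kappa> * norm g * (norm y)\<^sup>2" for y
      by (rule linearised_form_bound[OF t sol P(2) D lin_eq])
    moreover have "op (- D) y \<bullet> y \<le> \<kappa> * norm (- g) * (norm y)\<^sup>2" for y
    proof (rule linearised_form_bound[OF t sol P(2) subspace_neg[OF W_sub D]])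
      show "2 * pairing (A v) (hs_apply (- D) (i v)) + 2 * t * (\<Gamma> (op P (i v)) \<bullet> op (- D) (i v))
          = 2 * pairing (A v) (hs_apply (- g) (i v))" for v
        using lin_eq[of v] by simp
    qed
    ultimately have op_D: "norm (op D y) \<le> \<kappa> * norm g * norm y" for y
      by (intro norm_le_of_form_bound bounded_linear.linear[OF bounded_linear_op] op_sym[OF D])
        (auto simp: abs_le_iff)
    have q: "norm (quad D P) \<le> \<kappa> * norm g * (\<mu> * norm (Hs \<Gamma>))"
      using \<kappa> by (intro norm_quad_le_op[OF P(1) \<mu> op_P _ op_D]) simp
    then have q': "norm (quad P D) \<le> \<kappa> * norm g * (\<mu> * norm (Hs \<Gamma>))"
      using norm_quad_commute[OF P(1) D] by simp
    \<comment> \<open>The same upgrade for the linearised equation, starting from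
      \<open>op_D\<close>.\<close>
    have "norm D = norm (g - t *\<^sub>R (\<beta> P D + \<beta> D P))" by (simp add: g_def)
    also have "\<dots> \<le> norm g + t * norm (\<beta> P D + \<beta> D P)"
      using t(1) norm_triangle_ineq4[of g "t *\<^sub>R (\<beta> P D + \<beta> D P)"] by simp
    also have "\<dots> \<le> norm g + 1 * (K * (\<kappa> * norm g * (\<mu> * norm (Hs \<Gamma>)))
        + K * (\<kappa> * norm g * (\<mu> * norm (Hs \<Gamma>))))"
      unfolding \<beta>_def using t
      by (intro add_left_mono mult_mono norm_triangle_mono order_trans[OF K(2)]
          mult_left_mono[OF _ K(1)] q q') auto
    also have "\<dots> = (1 + 2 * (K * (\<kappa> * (\<mu> * norm (Hs \<Gamma>))))) * norm g"
      by (simp add: algebra_simps)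
    finally show "norm D \<le> (1 + 2 * (K * (\<kappa> * (\<mu> * norm (Hs \<Gamma>))))) * norm (D + t *\<^sub>R (\<beta> P D + \<beta> D P))"
      by (simp add: g_def)
  next
    \<comment> \<open>A negative eigenvalue \<open>- s\<close> of \<open>P\<close> has
      \<open>s \<le> onorm i * norm (P - Q)\<close>; within this radius
      \<open>t * s * \<gamma> < \<omega>\<close>, against the gap.\<close>
    show "0 < \<omega> / (2 * (\<gamma>' + 1))" using \<omega> \<gamma>' by simp
    fix t P Q assume t: "0 \<le> t" "t \<le> 1" and P: "P \<in> W" and eq: "P + t *\<^sub>R \<beta> P P = f"
      and Q: "Q \<in> W" "nonneg Q" and near: "norm (P - Q) \<le> \<omega> / (2 * (\<gamma>' + 1))"
    show "nonneg P"
    proof (rule ccontr)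
      assume "\<not> nonneg P"
      then obtain s z where s: "0 < s" and z: "z \<noteq> 0" "op P z = - s *\<^sub>R z" and le: "\<omega> \<le> t * s * \<gamma>"
        using not_nonneg_solution[OF t solves[OF P eq]] by blast
      have "s * (norm z)\<^sup>2 = - (op P z \<bullet> z)"
        by (simp add: z(2) power2_norm_eq_inner)
      also have "\<dots> \<le> - (op (P - Q) z \<bullet> z)"
        using Q(2) by (simp add: nonneg_def inner_diff_left)
      also have "\<dots> \<le> norm (op (P - Q) z) * norm z"
        using Cauchy_Schwarz_ineq2[of "op (P - Q) z" z] by linarith
      also have "\<dots> \<le> onorm i * norm (P - Q) * norm z * norm z"
        by (intro mult_right_mono norm_op_le) simp
      finally have "s * (norm z)\<^sup>2 \<le> onorm i * norm (P - Q) * (norm z)\<^sup>2"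
        by (simp add: power2_eq_square mult.assoc)
      then have "s \<le> onorm i * norm (P - Q)"
        using z(1) by simp
      also have "\<dots> \<le> onorm i * (\<omega> / (2 * (\<gamma>' + 1)))"
        by (intro mult_left_mono near onorm_pos_le i)
      finally have s_le: "s \<le> onorm i * (\<omega> / (2 * (\<gamma>' + 1)))" .
      have "t * s * \<gamma> \<le> 1 * (onorm i * (\<omega> / (2 * (\<gamma>' + 1)))) * \<gamma>"
        using t s \<gamma> s_le by (intro mult_right_mono mult_mono) auto
      also have "\<dots> = \<omega> * (\<gamma>' / (2 * (\<gamma>' + 1)))"
        by (simp add: \<gamma>'_def)
      also have "\<dots> < \<omega> * 1"
        using \<omega> \<gamma>' by (intro mult_strict_left_mono) (simp_all add: pos_divide_less_eq)
      finally show False using le by simp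
    qed
  qed
  then obtain P where "P \<in> W" "nonneg P" "P + 1 *\<^sub>R \<beta> P P = f" by auto
  then show ?thesis using solves by blast
qed

section \<open>Translation to the operator equation\<close>

text \<open>The adjoint of \<open>p\<close> as a map into \<open>V\<close>, after the Riesz map, is
  the candidate for the extension to the dual; symmetry of \<open>p\<close> will make it agree with
  \<open>op p\<close> on \<open>H\<close>.\<close>

lemma dual_extension:
  "adjoint (hs_apply p) (riesz \<xi>) \<bullet> h = pairing \<xi> (hs_apply p h)"
  by (metis inner_adjoint[OF bounded_linear_hs_apply] inner_commute pairing_riesz)

lemma dual_extension_to_dual:
  assumes "p \<in> W"
  shows "adjoint (hs_apply p) (riesz (to_dual i h)) = op p h"
proof -
  have "adjoint (hs_apply p) (riesz (to_dual i h)) \<bullet> y = op p h \<bullet> y" for y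
    unfolding dual_extension pairing_to_dual[OF i] using op_sym[OF assms, of h y]
    by (simp add: op_def)
  then show ?thesis by (metis vector_eq_ldot inner_commute)
qed

lemma bounded_linear_dual_extension: "bounded_linear (\<lambda>\<xi>. adjoint (hs_apply p) (riesz \<xi>))"
  by (intro bounded_linear_compose[OF bounded_linear_adjoint] bounded_linear_hs_apply
      bounded_linear_riesz)

lemma adjoint_op:
  assumes "p \<in> W"
  shows "adjoint (op p) = op p"
  by (rule adjoint_unique) (use op_sym[OF assms] in simp)

lemma restr_op: "restr i (op p) = hs_apply p"
  by (simp add: restr_def op_def fun_eq_iff inv_f_f[OF inj_i])

text \<open>The extension is Hilbert--Schmidt as the adjoint of \<open>hs_apply p\<close> followed
  by the inverse Riesz isometry.\<close>

lemma op_in_HS_V: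
  assumes p: "p \<in> W"
  shows "op p \<in> HS_V i"
proof -
  let ?Q = "\<lambda>\<xi>. adjoint (hs_apply p) (riesz \<xi>)"
  have "bounded_linear (\<lambda>u :: 'v. dual_of (\<lambda>v. u \<bullet> v))"
  proof (rule bounded_linear_intro[where K = 1])
    show "norm (dual_of (\<lambda>v. u \<bullet> v)) \<le> norm u * 1" for u :: 'v
      by (simp flip: norm_riesz)
    note dual = pairing_dual_of[OF bounded_linear_inner_right]
    show "dual_of (\<lambda>v. (u + w) \<bullet> v) = dual_of (\<lambda>v. u \<bullet> v) + dual_of (\<lambda>v. w \<bullet> v)" for u w :: 'v
      by (rule topdual_eqI, unfold dual pairing_simps, rule inner_add_left)
    show "dual_of (\<lambda>v. (r *\<^sub>R u) \<bullet> v) = r *\<^sub>R dual_of (\<lambda>v. u \<bullet> v)" for r and u :: 'v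
      by (rule topdual_eqI, unfold dual pairing_simps, rule inner_scaleR_left)
  qed
  then have "hilbert_schmidt (\<lambda>h. dual_of (\<lambda>v. hs_apply p h \<bullet> v))"
    by (rule hilbert_schmidt_comp[OF _ hilbert_schmidt_hs_apply])
  then have "hilbert_schmidt ?Q"
  proof (rule hilbert_schmidt_adjoint[OF _ bounded_linear_dual_extension])
    show "dual_of (\<lambda>v. hs_apply p h \<bullet> v) \<bullet> \<xi> = h \<bullet> ?Q \<xi>" for h \<xi>
      using dual_extension[of p \<xi> h]
      by (simp add: inner_topdual_def inner_commute[of h] pairing_riesz
          inner_commute[of "hs_apply p h" "riesz \<xi>"])
  qed
  moreover have "hilbert_schmidt (op p)"
    unfolding op_def by (rule hilbert_schmidt_comp[OF i hilbert_schmidt_hs_apply])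
  moreover have "range (op p) \<subseteq> range i" by (auto simp: op_def)
  ultimately show ?thesis
    unfolding HS_V_def using dual_extension_to_dual[OF p]
    by (auto simp: restr_op hilbert_schmidt_hs_apply intro!: exI[of _ ?Q])
qed

text \<open>With \<open>op_in_HS_V\<close> and \<open>adjoint_op\<close> this identifies the
  self-adjoint members of \<open>HS_V i\<close> with \<open>symmetric_hs i\<close>, so that
  existence and uniqueness carry over.\<close>

lemma self_adjoint_HS_V:
  assumes P: "P \<in> HS_V i" "P = adjoint P"
  obtains p where "p \<in> W" "P = op p"
proof
  let ?p = "Hs (restr i P)"
  have hs: "hilbert_schmidt (restr i P)" "bounded_linear P" and range: "range P \<subseteq> range i"
    using P by (auto simp: HS_V_def hilbert_schmidt_bounded_linear)
  have "i (inv i (P x)) = P x" for x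
    using range by (intro f_inv_into_f) auto
  then have eq: "i (hs_apply ?p x) = P x" for x
    by (simp add: hs(1)) (simp add: restr_def)
  then show "P = op ?p"
    by (simp add: op_def fun_eq_iff)
  have "P x \<bullet> y = x \<bullet> P y" for x y
    using inner_adjoint[OF hs(2), of x y] P(2) by simp
  then show "?p \<in> W"
    by (simp add: symmetric_hs_def eq)
qed

text \<open>An equality of functionals is tested on \<open>V\<close>; symmetry then moves the outer
  \<open>P\<close> of each product onto the test vector.\<close>

lemma riccati_equation_op:
  assumes p: "p \<in> W"
  shows "riccati_equation i A \<Gamma> F (op p) \<longleftrightarrow> solves 1 p"
proof -
  have ext: "ext i (op p) = (\<lambda>\<xi>. adjoint (hs_apply p) (riesz \<xi>))"
    by (rule ext_eqI[OF triple bounded_linear_dual_extension dual_extension_to_dual[OF p]])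
  have eq_iff: "\<xi> = \<zeta> \<longleftrightarrow> (\<forall>v. pairing \<xi> v = pairing \<zeta> v)" for \<xi> \<zeta> :: "'v topdual"
    using topdual_eqI by blast
  show ?thesis
    unfolding riccati_equation_def solves_def ext restr_op eq_iff lyapunov_form_def
    by (simp add: p pairing_to_dual[OF i] pairing_dual_adjoint[OF A] dual_extension op_sym[OF p]
        add_ac)
qed

lemma nonneg_operator_op: "nonneg_operator (op p) \<longleftrightarrow> nonneg p"
  by (simp add: nonneg_operator_def nonneg_def)

theorem ex1_riccati:
  "\<exists>!P. P \<in> HS_V i \<and> riccati_equation i A \<Gamma> F P \<and> P = adjoint P \<and> nonneg_operator P"
proof (rule ex_ex1I)
  obtain p where "solves 1 p" "nonneg p"
    using ex_solution by blast
  then show "\<exists>P. P \<in> HS_V i \<and> riccati_equation i A \<Gamma> F P \<and> P = adjoint P \<and> nonneg_operator P"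
    using solves_W op_in_HS_V riccati_equation_op adjoint_op nonneg_operator_op by metis
  fix P Q
  assume "P \<in> HS_V i \<and> riccati_equation i A \<Gamma> F P \<and> P = adjoint P \<and> nonneg_operator P"
    and "Q \<in> HS_V i \<and> riccati_equation i A \<Gamma> F Q \<and> Q = adjoint Q \<and> nonneg_operator Q"
  then show "P = Q"
    using solution_unique riccati_equation_op nonneg_operator_op by (metis self_adjoint_HS_V)
qed

end

theorem theorem2p1:
  fixes i :: "'v::{real_inner, polish_space} \<Rightarrow> 'h::{real_inner, polish_space}"
    and A :: "'v \<Rightarrow> 'v topdual"
    and F \<Gamma> :: "'h \<Rightarrow> 'h"
  assumes "gelfand_triple i" and "compact_operator i"
    and "bounded_linear A"
    and "\<exists>\<omega>>0. \<forall>y. pairing (A y) y \<ge> \<omega> * (norm y)\<^sup>2"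
    and "hilbert_schmidt F" and "F = adjoint F" and "nonneg_operator F"
    and "hilbert_schmidt \<Gamma>" and "\<Gamma> = adjoint \<Gamma>" and "nonneg_operator \<Gamma>"
  shows "\<exists>!P. P \<in> HS_V i \<and> riccati_equation i A \<Gamma> F P \<and> P = adjoint P \<and> nonneg_operator P"
proof -
  obtain \<omega> where \<omega>: "0 < \<omega>" "\<And>y. \<omega> * (norm y)\<^sup>2 \<le> pairing (A y) y"
    using assms(4) by blast
  have sym: "T x \<bullet> y = x \<bullet> T y" if "hilbert_schmidt T" "T = adjoint T" for T :: "'h \<Rightarrow> 'h" and x y
    using inner_adjoint[OF hilbert_schmidt_bounded_linear[OF that(1)], of x y] that(2) by simp
  interpret riccati_problem i A \<omega> F \<Gamma>
    using assms \<omega> sym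
    by (intro riccati_problem.intro coercive_operator.intro riccati_problem_axioms.intro)
      (auto simp: nonneg_operator_def)
  show ?thesis by (rule ex1_riccati)
qed

end
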